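(* Let $\mathbf m^0:\overline\Omega\to\mathbb R^3$ be continuous with $|\mathbf m^0|=1$. The numerical scheme (S) defined in the context has a unique solution and, for every $0\le n\le N-1$, satisfies $$\frac12\|\nabla\mathbf m_h^{n+1}\|_h^2+\Delta t\sum_{k=0}^n\|\mathbf m_h^k\times\widetilde\Delta_h\widetilde{\mathbf m}_h^{k+1}\|_h^2\le\frac12\|\nabla\mathbf m_h^0\|_h^2 .$$
   Context: Mesh and space: $d\in\{1,2,3\}$; $\Omega\subset\mathbb R^d$ is a bounded rectangular domain (product of intervals). $\mathscr T_h$ is a mesh of $\Omega$ into Cartesian boxes generated by the tensor product of one-dimensional partitions in each coordinate direction (from a shape-regular, quasi-uniform family). $Q_1(K)$ is the space of polynomials on $K$ of degree at most $1$ in each variable, and $\mathbf S_h^1=\{\mathbf v_h\in H^1(\Omega)^3:\mathbf v_h|_K\in Q_1(K)^3\ \forall K\in\mathscr T_h\}$. $\mathcal Q_K$ is the set of vertices of $K$, $\mathcal Q$ the set of all mesh vertices (finite element nodes), $I_h$ the nodal $Q_1$ interpolation operator at $\mathcal Q$ (applied componentwise). Quadrature: the tensor-product two-point Gauss--Lobatto rule, with weights $\omega_{K,\mathbf z}=2^{-d}|K|$, $\mathbf z\in\mathcal Q_K$. For functions with nodal values, $(\mathbf v,\mathbf w)_h=\sum_K\sum_{\mathbf z\in\mathcal Q_K}\omega_{K,\mathbf z}\,\mathbf v(\mathbf z)\cdot\mathbf w(\mathbf z)$ and $\|\mathbf v\|_h^2=(\mathbf v,\mathbf v)_h$; for gradients,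 $(\nabla\mathbf v,\nabla\mathbf w)_h=\sum_K\sum_{\mathbf z\in\mathcal Q_K}\omega_{K,\mathbf z}\nabla(\mathbf v|_K)(\mathbf z)\cdot\nabla(\mathbf w|_K)(\mathbf z)$ (Frobenius product, gradients taken elementwise) and $\|\nabla\mathbf v\|_h^2=(\nabla\mathbf v,\nabla\mathbf v)_h$. The discrete Laplacian $\widetilde\Delta_h:\mathbf S_h^1\to\mathbf S_h^1$ is defined by $(\widetilde\Delta_h\mathbf v_h,\mathbf w_h)_h=-(\nabla\mathbf v_h,\nabla\mathbf w_h)_h$ for all $\mathbf w_h\in\mathbf S_h^1$. Scheme (S): $T>0$, $N\in\mathbb N$, $\Delta t=T/N$. Set $\mathbf m_h^0=\widetilde{\mathbf m}_h^0=I_h\mathbf m^0$. For $n=0,\dots,N-1$ find $\widetilde{\mathbf m}_h^{n+1}\in\mathbf S_h^1$ such that for all $\mathbf v_h\in\mathbf S_h^1$ $$\Big(\tfrac{\widetilde{\mathbf m}_h^{n+1}-\mathbf m_h^n}{\Delta t},\mathbf v_h\Big)_h=-\big(\mathbf m_h^n\times(\mathbf m_h^n\times\widetilde\Delta_h\widetilde{\mathbf m}_h^{n+1}),\mathbf v_h\big)_h,$$ and set $\mathbf m_h^{n+1}=I_h\big(\widetilde{\mathbf m}_h^{n+1}/|\widetilde{\mathbf m}_h^{n+1}|\big)$. *)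

theory Defs
  imports "HOL-Analysis.Analysis"
begin

section \<open>Cartesian meshes\<close>

definition interval_partition :: "real \<Rightarrow> real \<Rightarrow> nat \<Rightarrow> (nat \<Rightarrow> real) \<Rightarrow> bool" where
  "interval_partition \<alpha> \<beta> M t \<longleftrightarrow> t 0 = \<alpha> \<and> t M = \<beta> \<and> (\<forall>j<M. t j < t (Suc j))"

text \<open>\<open>t i\<close> lists the \<open>M i + 1\<close> break points in the \<open>i\<close>-th coordinate direction; cells are closed boxes.\<close>

definition cartesian_mesh :: "(real^'d) set \<Rightarrow> (real^'d) set set \<Rightarrow> bool" where
  "cartesian_mesh \<Omega> Th \<longleftrightarrow>
    (\<exists>a b M t. (\<forall>i. a $ i < b $ i) \<and> \<Omega> = box a b
      \<and> (\<forall>i. interval_partition (a $ i) (b $ i) (M i) (t i))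
      \<and> Th = {cbox (\<chi> i. t i (k i)) (\<chi> i. t i (Suc (k i))) | k. \<forall>i. k i < M i})"

definition shape_regular :: "(real^'d) set set set \<Rightarrow> bool" where
  "shape_regular F \<longleftrightarrow>
    (\<exists>\<sigma>>0. \<forall>Th\<in>F. \<forall>K\<in>Th. \<exists>c r. cball c r \<subseteq> K \<and> diameter K \<le> \<sigma> * r)"

definition quasi_uniform :: "(real^'d) set set set \<Rightarrow> bool" where
  "quasi_uniform F \<longleftrightarrow>
    (\<exists>C>0. \<forall>Th\<in>F. \<forall>K\<in>Th. \<forall>K'\<in>Th. diameter K \<le> C * diameter K')"

definition vertices :: "(real^'d) set \<Rightarrow> (real^'d) set" where
  "vertices K = {z. z extreme_point_of K}"

definition nodes :: "(real^'d) set set \<Rightarrow> (real^'d) set" where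
  "nodes Th = (\<Union>K\<in>Th. vertices K)"


section \<open>The Sobolev space \<open>H\<^sup>1\<close>\<close>

definition partial_deriv :: "'d \<Rightarrow> (real^'d \<Rightarrow> real) \<Rightarrow> real^'d \<Rightarrow> real" where
  "partial_deriv i f x = frechet_derivative f (at x) (axis i 1)"

primrec cont_diff :: "nat \<Rightarrow> (real^'d \<Rightarrow> real) \<Rightarrow> bool" where
  "cont_diff 0 f \<longleftrightarrow> continuous_on UNIV f"
| "cont_diff (Suc k) f \<longleftrightarrow> (\<forall>x. f differentiable (at x)) \<and> (\<forall>i. cont_diff k (partial_deriv i f))"

definition test_functions :: "(real^'d) set \<Rightarrow> (real^'d \<Rightarrow> real) set" where
  "test_functions \<Omega> = {\<phi>. (\<forall>k. cont_diff k \<phi>)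
     \<and> compact (closure {x. \<phi> x \<noteq> 0}) \<and> closure {x. \<phi> x \<noteq> 0} \<subseteq> \<Omega>}"

definition L2 :: "(real^'d) set \<Rightarrow> (real^'d \<Rightarrow> real) set" where
  "L2 \<Omega> = {u. u \<in> borel_measurable (lebesgue_on \<Omega>) \<and> integrable (lebesgue_on \<Omega>) (\<lambda>x. (u x)\<^sup>2)}"

definition weak_partial :: "(real^'d) set \<Rightarrow> 'd \<Rightarrow> (real^'d \<Rightarrow> real) \<Rightarrow> (real^'d \<Rightarrow> real) \<Rightarrow> bool" where
  "weak_partial \<Omega> i u g \<longleftrightarrow>
    (\<forall>\<phi>\<in>test_functions \<Omega>.
       (LINT x|lebesgue_on \<Omega>. u x * partial_deriv i \<phi> x) = - (LINT x|lebesgue_on \<Omega>. g x * \<phi> x))"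

definition H1 :: "(real^'d) set \<Rightarrow> (real^'d \<Rightarrow> real) set" where
  "H1 \<Omega> = {u. u \<in> L2 \<Omega> \<and> (\<forall>i. \<exists>g\<in>L2 \<Omega>. weak_partial \<Omega> i u g)}"


section \<open>The finite element space\<close>

definition Q1 :: "(real^'d) set \<Rightarrow> (real^'d \<Rightarrow> real) set" where
  "Q1 K = {f. \<exists>c. \<forall>x\<in>K. f x = (\<Sum>\<alpha> | \<forall>i. \<alpha> i \<le> (1::nat). c \<alpha> * (\<Prod>i\<in>UNIV. (x $ i) ^ \<alpha> i))}"

text \<open>An element of the finite element space is represented by its continuous representative on
  \<open>closure \<Omega>\<close> (cells are closed, so the values at the nodes are determined), extended by zero so
  that equality of functions is equality in the space.\<close>

definition Sh :: "(real^'d) set \<Rightarrow> (real^'d) set set \<Rightarrow> (real^'d \<Rightarrow> real^3) set" where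
  "Sh \<Omega> Th = {v. (\<forall>j. (\<lambda>x. v x $ j) \<in> H1 \<Omega>)
      \<and> (\<forall>K\<in>Th. \<forall>j. (\<lambda>x. v x $ j) \<in> Q1 K)
      \<and> (\<forall>x. x \<notin> closure \<Omega> \<longrightarrow> v x = 0)}"

definition interp :: "(real^'d) set \<Rightarrow> (real^'d) set set \<Rightarrow> (real^'d \<Rightarrow> real^3) \<Rightarrow> real^'d \<Rightarrow> real^3" where
  "interp \<Omega> Th f = (THE v. v \<in> Sh \<Omega> Th \<and> (\<forall>z\<in>nodes Th. v z = f z))"


section \<open>Mass-lumped inner products and discrete Laplacian\<close>

definition quad_weight :: "(real^'d) set \<Rightarrow> real" where
  "quad_weight K = measure lebesgue K / 2 ^ CARD('d)"

definition inner_h :: "(real^'d) set set \<Rightarrow> (real^'d \<Rightarrow> real^3) \<Rightarrow> (real^'d \<Rightarrow> real^3) \<Rightarrow> real" where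
  "inner_h Th v w = (\<Sum>K\<in>Th. \<Sum>z\<in>vertices K. quad_weight K * (v z \<bullet> w z))"

definition norm_h :: "(real^'d) set set \<Rightarrow> (real^'d \<Rightarrow> real^3) \<Rightarrow> real" where
  "norm_h Th v = sqrt (inner_h Th v v)"

text \<open>The derivative within \<open>K\<close> at a vertex is the one-sided gradient of \<open>v\<close> restricted to \<open>K\<close>, and the
  inner product of \<open>real^'d^3\<close> is the Frobenius product.\<close>

definition grad_inner_h :: "(real^'d) set set \<Rightarrow> (real^'d \<Rightarrow> real^3) \<Rightarrow> (real^'d \<Rightarrow> real^3) \<Rightarrow> real" where
  "grad_inner_h Th v w =
    (\<Sum>K\<in>Th. \<Sum>z\<in>vertices K.
       quad_weight K * (jacobian v (at z within K) \<bullet> jacobian w (at z within K)))"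

definition grad_norm_h :: "(real^'d) set set \<Rightarrow> (real^'d \<Rightarrow> real^3) \<Rightarrow> real" where
  "grad_norm_h Th v = sqrt (grad_inner_h Th v v)"

definition discrete_laplacian ::
  "(real^'d) set \<Rightarrow> (real^'d) set set \<Rightarrow> (real^'d \<Rightarrow> real^3) \<Rightarrow> real^'d \<Rightarrow> real^3" where
  "discrete_laplacian \<Omega> Th v =
    (THE u. u \<in> Sh \<Omega> Th \<and> (\<forall>w\<in>Sh \<Omega> Th. inner_h Th u w = - grad_inner_h Th v w))"


section \<open>The projection scheme\<close>

text \<open>The pair \<open>(mt, m)\<close> collects the iterates before and after normalisation. Since division by
  zero is total in HOL, that the normalisation is meaningful (\<open>mt (Suc n) z \<noteq> 0\<close> at every node) is
  stated as part of being a solution.\<close>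

definition scheme_solution ::
  "(real^'d) set \<Rightarrow> (real^'d) set set \<Rightarrow> (real^'d \<Rightarrow> real^3) \<Rightarrow> real \<Rightarrow> nat
    \<Rightarrow> (nat \<Rightarrow> real^'d \<Rightarrow> real^3) \<times> (nat \<Rightarrow> real^'d \<Rightarrow> real^3) \<Rightarrow> bool" where
  "scheme_solution \<Omega> Th m0 T N = (\<lambda>(mt, m).
     mt \<in> {0..N} \<rightarrow>\<^sub>E Sh \<Omega> Th \<and> m \<in> {0..N} \<rightarrow>\<^sub>E Sh \<Omega> Th
     \<and> m 0 = interp \<Omega> Th m0 \<and> mt 0 = interp \<Omega> Th m0
     \<and> (\<forall>n<N.
          (\<forall>v\<in>Sh \<Omega> Th.
             inner_h Th (\<lambda>x. (mt (Suc n) x - m n x) /\<^sub>R (T / real N)) v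
             = - inner_h Th (\<lambda>x. cross3 (m n x) (cross3 (m n x)
                                  (discrete_laplacian \<Omega> Th (mt (Suc n)) x))) v)
          \<and> (\<forall>z\<in>nodes Th. mt (Suc n) z \<noteq> 0)
          \<and> m (Suc n) = interp \<Omega> Th (\<lambda>x. mt (Suc n) x /\<^sub>R norm (mt (Suc n) x))))"

end

theory Submission
  imports Defs "HOL-Library.Function_Algebras"
begin

text \<open>Because of mass lumping the scheme is an equation at each node, \<open>u - m = - \<tau> m \<times> (m \<times> \<Delta>\<^sub>h u)\<close>,
  and by the vertex quadrature \<open>(\<nabla>v, \<nabla>w)\<^sub>h\<close> is a sum over edges with nonnegative weights of products of
  differences of nodal values. Pairing the equation with \<open>\<Delta>\<^sub>h u\<close> gives
  \<open>(\<nabla>u, \<nabla>(u - m))\<^sub>h = - \<tau> \<parallel>m \<times> \<Delta>\<^sub>h u\<parallel>\<^sub>h\<^sup>2\<close>. For the homogeneous system (\<open>u\<close> instead of \<open>u - m\<close>)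
  the same pairing forces \<open>u = 0\<close>, hence each step is uniquely solvable; as it stands it bounds the energy of \<open>u\<close>.
  Since \<open>u - m\<close> is orthogonal to the unit vector \<open>m\<close>, \<open>\<bar>u\<bar> \<ge> 1\<close> at every node, and \<open>x \<mapsto> x / \<bar>x\<bar>\<close> is a
  contraction outside the unit ball, so normalising at the nodes does not increase any edge term.\<close>

section \<open>Linear operators on finitely supported functions\<close>

text \<open>\<open>interp\<close> and \<open>discrete_laplacian\<close> are definite descriptions
  over \<open>Sh\<close>, and \<open>Sh\<close> asks for weak derivatives in \<open>L2\<close>.
  Nothing can be computed with them until nodal values are known to parametrise \<open>Sh\<close>:
  any nodal values are attained (by tensor products of hat functions, whose weak derivatives have to
  be exhibited against test functions), and by one element only (a \<open>Q1\<close> function is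
  fixed by its vertex values). After that, mesh and function space can be forgotten: a finite set of
  nodes with lumped masses and a weighted graph carries the whole analysis. The edge form is
  diagonal because, on a box, each partial derivative at a vertex is the difference quotient along a
  single edge, so differences over distinct edges are never multiplied; this is what allows a
  comparison edge by edge. The sign of the dissipation comes from the skewness of the cross product
  with \<open>m\<close>.\<close>

lemma finite_support_injective_imp_surjective:
  fixes L :: "('a \<Rightarrow> 'b::euclidean_space) \<Rightarrow> 'a \<Rightarrow> 'b"
  assumes "finite Z"
    and add: "\<And>u v z. L (\<lambda>x. u x + v x) z = L u z + L v z"
    and scale: "\<And>c u z. L (\<lambda>x. c *\<^sub>R u x) z = c *\<^sub>R L u z"
    and inj: "\<And>u. (\<And>z. z \<notin> Z \<Longrightarrow> u z = 0) \<Longrightarrow> (\<And>z. z \<in> Z \<Longrightarrow> L u z = 0) \<Longrightarrow> u = (\<lambda>z. 0)"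
  obtains u where "\<And>z. z \<in> Z \<Longrightarrow> L u z = f z"
proof -
  \<comment> \<open>Pointwise addition comes from \<open>Function_Algebras\<close>;
    \<open>sc\<close> adds the scalar multiplication, so that the locale \<open>vector_space\<close>
    applies to functions.\<close>
  define sc :: "real \<Rightarrow> ('a \<Rightarrow> 'b) \<Rightarrow> 'a \<Rightarrow> 'b" where "sc = (\<lambda>c u x. c *\<^sub>R u x)"
  interpret V: vector_space sc
    by unfold_locales (auto simp: sc_def fun_eq_iff scaleR_add_right scaleR_add_left)
  define W where "W = {u :: 'a \<Rightarrow> 'b. \<forall>z. z \<notin> Z \<longrightarrow> u z = 0}"
  \<comment> \<open>Cutting \<open>L\<close> off outside \<open>Z\<close> makes it an endomorphism
    of \<open>W\<close>, which is finite-dimensional: the one-point functions in \<open>E\<close>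
    span it.\<close>
  define G where "G = (\<lambda>u z. if z \<in> Z then L u z else 0)"
  define E where "E = (\<lambda>(z, b) x. if x = z then b else 0 :: 'b) ` (Z \<times> Basis)"
  have "finite E" unfolding E_def using \<open>finite Z\<close> by simp
  interpret G: Vector_Spaces.linear sc sc G
    by unfold_locales (auto simp: sc_def G_def fun_eq_iff plus_fun_def add scale)
  have W: "V.subspace W"
    by (rule V.subspaceI) (auto simp: W_def sc_def)
  have "W \<subseteq> V.span E"
  proof
    fix u assume u: "u \<in> W"
    have "u = (\<Sum>z\<in>Z. \<Sum>b\<in>Basis. sc (u z \<bullet> b) (\<lambda>x. if x = z then b else 0))" (is "_ = ?s")
    proof
      fix x
      have ap: "sum h A x = (\<Sum>a\<in>A. h a x)" for h :: "'c \<Rightarrow> 'a \<Rightarrow> 'b" and A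
        by (induction A rule: infinite_finite_induct) auto
      have "?s x = (\<Sum>z\<in>Z. if x = z then (\<Sum>b\<in>Basis. (u z \<bullet> b) *\<^sub>R b) else 0)"
        by (auto simp: ap sc_def intro!: sum.cong)
      also have "\<dots> = u x"
        using u \<open>finite Z\<close> by (auto simp: euclidean_representation W_def)
      finally show "u x = ?s x" by simp
    qed
    moreover have "?s \<in> V.span E"
      by (intro V.span_sum V.span_scale V.span_base) (auto simp: E_def)
    ultimately show "u \<in> V.span E" by simp
  qed
  moreover have "E \<subseteq> W" by (auto simp: E_def W_def)
  ultimately have spanE: "V.span E = W"
    using W V.span_minimal by blast
  obtain B where B: "B \<subseteq> E" "V.independent B" "E \<subseteq> V.span B"
    using V.maximal_independent_subset[of E] by blast
  have "finite B" using B(1) \<open>finite E\<close> finite_subset by blast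
  have spanB: "V.span B = W"
    using B spanE by (metis V.span_mono V.span_minimal V.subspace_span subset_antisym)
  have "inj_on G W"
  proof (subst G.inj_on_iff_eq_0[OF W], intro ballI impI)
    fix u assume u: "u \<in> W" "G u = 0"
    show "u = 0"
      unfolding zero_fun_def
    proof (rule inj)
      show "L u z = 0" if "z \<in> Z" for z
        using fun_cong[OF u(2), of z] that by (simp add: G_def)
    qed (use u in \<open>auto simp: W_def\<close>)
  qed
  then have ind: "V.independent (G ` B)"
    using G.independent_injective_image[OF B(2)] spanB by simp
  have card: "card (G ` B) = card B"
    using \<open>inj_on G W\<close> spanB V.span_superset[of B] by (meson card_image inj_on_subset subset_trans order_refl)
  have GW: "G u \<in> W" for u by (simp add: G_def W_def)
  have "W \<subseteq> V.span (G ` B)"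
  proof (rule ccontr)
    assume "\<not> W \<subseteq> V.span (G ` B)"
    then obtain w where w: "w \<in> W" "w \<notin> V.span (G ` B)" by blast
    then have "V.independent (insert w (G ` B))"
      using ind V.independent_insert by auto
    moreover have "insert w (G ` B) \<subseteq> V.span B"
      using w GW spanB by auto
    ultimately have "card (insert w (G ` B)) \<le> card B"
      using V.independent_span_bound[OF \<open>finite B\<close>] by blast
    moreover have "w \<notin> G ` B" using w V.span_base by blast
    ultimately show False
      using card \<open>finite B\<close> by simp
  qed
  moreover have "(\<lambda>z. if z \<in> Z then f z else 0) \<in> W" by (simp add: W_def)
  ultimately have "(\<lambda>z. if z \<in> Z then f z else 0) \<in> G ` V.span B"
    using G.span_image by blast
  then obtain u where u: "(\<lambda>z. if z \<in> Z then f z else 0) = G u" by blast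
  show ?thesis
  proof (rule that)
    show "L u z = f z" if "z \<in> Z" for z
      using fun_cong[OF u, of z] that by (simp add: G_def)
  qed
qed

section \<open>The local space \<open>Q\<^sub>1\<close>\<close>

lemma prod_nth_add_axis:
  fixes x :: "real^'d"
  shows "(\<Prod>j\<in>UNIV. ((x + s *\<^sub>R axis i 1) $ j) ^ \<alpha> j)
    = (x $ i + s) ^ \<alpha> i * (\<Prod>j\<in>UNIV - {i}. (x $ j) ^ \<alpha> j)"
proof -
  have "(\<Prod>j\<in>UNIV. ((x + s *\<^sub>R axis i 1) $ j) ^ \<alpha> j)
    = ((x + s *\<^sub>R axis i 1) $ i) ^ \<alpha> i * (\<Prod>j\<in>UNIV - {i}. ((x + s *\<^sub>R axis i 1) $ j) ^ \<alpha> j)"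
    by (subst prod.remove[of _ i]) auto
  also have "(\<Prod>j\<in>UNIV - {i}. ((x + s *\<^sub>R axis i 1) $ j) ^ \<alpha> j) = (\<Prod>j\<in>UNIV - {i}. (x $ j) ^ \<alpha> j)"
    by (intro prod.cong) (auto simp: axis_def)
  finally show ?thesis by (simp add: axis_def)
qed

text \<open>Keeps just what is used of a \<open>Q1\<close> polynomial, without coefficients:
  differentiability and affinity along each coordinate line, the slope being the increment over a
  unit step.\<close>

definition multiaffine :: "(real^'d \<Rightarrow> real) \<Rightarrow> bool" where
  "multiaffine p \<longleftrightarrow> (\<forall>x. p differentiable (at x)) \<and>
    (\<forall>x i s. p (x + s *\<^sub>R axis i 1) = p x + s * (p (x + axis i 1) - p x))"

text \<open>\<open>Q1 K\<close> says nothing about \<open>f\<close> off \<open>K\<close>. Passing to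
  the polynomial itself gives a function on the whole space, with genuine derivatives at the
  vertices of \<open>K\<close>.\<close>

lemma Q1_multiaffine:
  fixes f :: "real^'d \<Rightarrow> real"
  assumes "f \<in> Q1 K"
  obtains p where "multiaffine p" "\<And>x. x \<in> K \<Longrightarrow> f x = p x"
proof -
  obtain c where c: "\<And>x. x \<in> K \<Longrightarrow> f x = (\<Sum>\<alpha> | \<forall>i. \<alpha> i \<le> (1::nat). c \<alpha> * (\<Prod>i\<in>UNIV. (x $ i) ^ \<alpha> i))"
    using assms unfolding Q1_def by blast
  let ?p = "\<lambda>x::real^'d. \<Sum>\<alpha> | \<forall>i. \<alpha> i \<le> (1::nat). c \<alpha> * (\<Prod>i\<in>UNIV. (x $ i) ^ \<alpha> i)"
  \<comment> \<open>Exponents are 0 or 1, so every power is affine in its base.\<close>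
  have pw: "(r + s) ^ k = r ^ k + s * ((r + 1) ^ k - r ^ k)" if "k \<le> 1" for r s :: real and k :: nat
    using that by (cases "k = 0") (auto simp: le_Suc_eq algebra_simps)
  have "multiaffine ?p"
    unfolding multiaffine_def
  proof (intro conjI allI)
    fix x :: "real^'d"
    show "?p differentiable (at x)"
      unfolding differentiable_def
      by (rule exI) (rule derivative_eq_intros refl has_derivative_prod bounded_linear.has_derivative[OF bounded_linear_vec_nth] has_derivative_ident | simp)+
  next
    fix x :: "real^'d" and i s
    have "c \<alpha> * (\<Prod>j\<in>UNIV. ((x + s *\<^sub>R axis i 1) $ j) ^ \<alpha> j) =
        c \<alpha> * (\<Prod>j\<in>UNIV. (x $ j) ^ \<alpha> j) + s * (c \<alpha> * (\<Prod>j\<in>UNIV. ((x + axis i 1) $ j) ^ \<alpha> j) - c \<alpha> * (\<Prod>j\<in>UNIV. (x $ j) ^ \<alpha> j))"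
      if "\<forall>i. \<alpha> i \<le> 1" for \<alpha> :: "'d \<Rightarrow> nat"
    proof -
      have e0: "(\<Prod>j\<in>UNIV. (x $ j) ^ \<alpha> j) = (x $ i) ^ \<alpha> i * (\<Prod>j\<in>UNIV - {i}. (x $ j) ^ \<alpha> j)"
        by (rule prod.remove) auto
      have e1: "(\<Prod>j\<in>UNIV. ((x + axis i 1) $ j) ^ \<alpha> j) = (x $ i + 1) ^ \<alpha> i * (\<Prod>j\<in>UNIV - {i}. (x $ j) ^ \<alpha> j)"
        using prod_nth_add_axis[of x 1 i \<alpha>] by simp
      have e2: "(x $ i + s) ^ \<alpha> i = (x $ i) ^ \<alpha> i + s * ((x $ i + 1) ^ \<alpha> i - (x $ i) ^ \<alpha> i)"
        using pw that by blast
      show ?thesis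
        unfolding prod_nth_add_axis e0 e1 e2 by (simp add: algebra_simps)
    qed
    then have "?p (x + s *\<^sub>R axis i 1) = (\<Sum>\<alpha> | \<forall>i. \<alpha> i \<le> (1::nat). c \<alpha> * (\<Prod>j\<in>UNIV. (x $ j) ^ \<alpha> j) + s * (c \<alpha> * (\<Prod>j\<in>UNIV. ((x + axis i 1) $ j) ^ \<alpha> j) - c \<alpha> * (\<Prod>j\<in>UNIV. (x $ j) ^ \<alpha> j)))"
      by (intro sum.cong) auto
    also have "\<dots> = ?p x + s * (?p (x + axis i 1) - ?p x)"
      by (simp only: sum.distrib sum_distrib_left[symmetric] sum_subtractf)
    finally show "?p (x + s *\<^sub>R axis i 1) = ?p x + s * (?p (x + axis i 1) - ?p x)" .
  qed
  then show ?thesis using that[of ?p] c by blast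
qed

lemma Q1_add: "f \<in> Q1 K \<Longrightarrow> g \<in> Q1 K \<Longrightarrow> (\<lambda>x. f x + g x) \<in> Q1 K"
proof -
  assume "f \<in> Q1 K" "g \<in> Q1 K"
  then obtain c d where "\<forall>x\<in>K. f x = (\<Sum>\<alpha> | \<forall>i. \<alpha> i \<le> (1::nat). c \<alpha> * (\<Prod>i\<in>UNIV. (x $ i) ^ \<alpha> i))"
    "\<forall>x\<in>K. g x = (\<Sum>\<alpha> | \<forall>i. \<alpha> i \<le> (1::nat). d \<alpha> * (\<Prod>i\<in>UNIV. (x $ i) ^ \<alpha> i))"
    unfolding Q1_def by blast
  then show ?thesis unfolding Q1_def
    by (intro CollectI exI[of _ "\<lambda>\<alpha>. c \<alpha> + d \<alpha>"]) (simp add: sum.distrib distrib_right)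
qed

lemma Q1_cmult: "f \<in> Q1 K \<Longrightarrow> (\<lambda>x. c * f x) \<in> Q1 K"
proof -
  assume "f \<in> Q1 K"
  then obtain d where "\<forall>x\<in>K. f x = (\<Sum>\<alpha> | \<forall>i. \<alpha> i \<le> (1::nat). d \<alpha> * (\<Prod>i\<in>UNIV. (x $ i) ^ \<alpha> i))"
    unfolding Q1_def by blast
  then show ?thesis unfolding Q1_def
    by (intro CollectI exI[of _ "\<lambda>\<alpha>. c * d \<alpha>"]) (simp add: sum_distrib_left mult.assoc)
qed

lemma Q1_sum: "(\<And>a. a \<in> A \<Longrightarrow> f a \<in> Q1 K) \<Longrightarrow> (\<lambda>x. \<Sum>a\<in>A. f a x) \<in> Q1 K"
proof (induction A rule: infinite_finite_induct)
  case (insert a A)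
  then show ?case using Q1_add[of "f a" K "\<lambda>x. \<Sum>a\<in>A. f a x"] by simp
qed (auto simp: Q1_def intro!: exI[of _ "\<lambda>_. 0"])

lemma Q1_cong: "f \<in> Q1 K \<Longrightarrow> (\<And>x. x \<in> K \<Longrightarrow> f x = g x) \<Longrightarrow> g \<in> Q1 K"
  unfolding Q1_def by fastforce

text \<open>Expanding the product picks the constant or the linear term of each factor; the choices
  are exactly the exponents \<alpha>.\<close>

lemma Q1_prod_affine:
  fixes f :: "'d::finite \<Rightarrow> real \<Rightarrow> real"
  assumes "\<And>x i. x \<in> K \<Longrightarrow> f i (x $ i) = A i + B i * (x $ i)"
  shows "(\<lambda>x. \<Prod>i\<in>UNIV. f i (x $ i)) \<in> Q1 K"
proof -
  have "(\<Prod>i\<in>UNIV. f i (x $ i)) =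
      (\<Sum>\<alpha> | \<forall>i. \<alpha> i \<le> (1::nat). (\<Prod>i\<in>UNIV. if \<alpha> i = 0 then A i else B i) * (\<Prod>i\<in>UNIV. (x $ i) ^ \<alpha> i))"
    if "x \<in> K" for x
  proof -
    have "(\<Prod>i\<in>UNIV. f i (x $ i)) = (\<Prod>i\<in>UNIV. \<Sum>k\<in>{0,1::nat}. (if k = 0 then A i else B i) * (x $ i) ^ k)"
      using assms[OF that] by (intro prod.cong) auto
    also have "\<dots> = (\<Sum>\<alpha>\<in>Pi\<^sub>E UNIV (\<lambda>_. {0,1::nat}). \<Prod>i\<in>UNIV. (if \<alpha> i = 0 then A i else B i) * (x $ i) ^ \<alpha> i)"
      by (rule prod_sum_PiE) auto
    also have "Pi\<^sub>E UNIV (\<lambda>_. {0,1::nat}) = {\<alpha> :: 'd \<Rightarrow> nat. \<forall>i. \<alpha> i \<le> 1}"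
      by (auto simp: PiE_def Pi_def le_Suc_eq)
    finally show ?thesis by (simp add: prod.distrib)
  qed
  then show ?thesis
    unfolding Q1_def by (intro CollectI exI[of _ "\<lambda>\<alpha>. \<Prod>i\<in>UNIV. if \<alpha> i = 0 then A i else B i"] ballI)
qed

section \<open>Vertex values and vertex gradients on a single box\<close>

definition upd :: "real^'d \<Rightarrow> 'd \<Rightarrow> real \<Rightarrow> real^'d" where
  "upd z i s = (\<chi> j. if j = i then s else z $ j)"

lemma upd_nth: "upd z i s $ j = (if j = i then s else z $ j)"
  by (simp add: upd_def)

lemma upd_eq_add_axis: "upd z i s = z + (s - z $ i) *\<^sub>R axis i 1"
  by (simp add: vec_eq_iff upd_nth axis_def)

lemma multiaffine_upd:
  assumes "multiaffine p"
  shows "p (upd z i s) = p z + (s - z $ i) * (p (z + axis i 1) - p z)"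
  using assms unfolding multiaffine_def upd_eq_add_axis
  by (drule_tac conjunct2) (drule_tac x = z in spec, drule_tac x = i in spec, erule spec)

lemma multiaffine_interpolate:
  assumes "multiaffine p" "a \<noteq> b"
  shows "p x = ((b - x $ i) * p (upd x i a) + (x $ i - a) * p (upd x i b)) / (b - a)"
proof -
  define d where "d = p (x + axis i 1) - p x"
  have upd: "p (upd x i s) = p x + (s - x $ i) * d" for s
    unfolding d_def by (rule multiaffine_upd[OF assms(1)])
  have "(b - x $ i) * p (upd x i a) + (x $ i - a) * p (upd x i b) = (b - a) * p x"
    unfolding upd by (simp add: algebra_simps)
  then show ?thesis using assms(2) by simp
qed

text \<open>The slope is the same along the whole line through \<open>z\<close> in direction
  \<open>i\<close>, so it can be read off at any two of its points, in particular at the ends of an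
  edge.\<close>

lemma frechet_derivative_multiaffine:
  assumes "multiaffine p" "a \<noteq> b"
  shows "frechet_derivative p (at z) (axis i 1) = (p (upd z i b) - p (upd z i a)) / (b - a)"
proof -
  let ?q = "p (z + axis i 1) - p z"
  have D: "(p has_derivative frechet_derivative p (at z)) (at z)"
    using assms(1) frechet_derivative_works unfolding multiaffine_def by blast
  have "((\<lambda>s. z + s *\<^sub>R axis i 1) has_derivative (\<lambda>s. s *\<^sub>R axis i 1)) (at (0::real))"
    by (auto intro!: derivative_eq_intros)
  then have "((\<lambda>s. p (z + s *\<^sub>R axis i 1)) has_derivative (\<lambda>s. frechet_derivative p (at z) (s *\<^sub>R axis i 1))) (at (0::real))"
    using has_derivative_compose[of "\<lambda>s. z + s *\<^sub>R axis i 1" _ 0 UNIV p] D by simp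
  moreover have "(\<lambda>s. p (z + s *\<^sub>R axis i 1)) = (\<lambda>s. p z + s * ?q)"
    using assms(1) unfolding multiaffine_def by blast
  moreover have "((\<lambda>s. p z + s * ?q) has_derivative (\<lambda>s. s * ?q)) (at 0)"
    by (auto intro!: derivative_eq_intros)
  ultimately have "(\<lambda>s. frechet_derivative p (at z) (s *\<^sub>R axis i 1)) = (\<lambda>s. s * ?q)"
    using has_derivative_unique by metis
  from fun_cong[OF this, of 1] have "frechet_derivative p (at z) (axis i 1) = ?q" by simp
  moreover have "p (upd z i b) - p (upd z i a) = (b - a) * ?q"
    unfolding multiaffine_upd[OF assms(1)] by (simp add: left_diff_distrib)
  ultimately show ?thesis using assms(2) by simp
qed

text \<open>A coordinate strictly inside its interval can be moved both ways, so the point is a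
  midpoint of others. Conversely, a coordinate at a bound forces both ends of any segment through
  the point to that bound.\<close>

lemma vertices_cbox:
  fixes a b :: "real^'d"
  assumes "\<And>i. a $ i < b $ i"
  shows "vertices (cbox a b) = {z. \<forall>i. z $ i = a $ i \<or> z $ i = b $ i}"
proof (intro set_eqI iffI)
  fix z assume "z \<in> vertices (cbox a b)"
  then have z: "z extreme_point_of cbox a b" by (simp add: vertices_def)
  then have zK: "z \<in> cbox a b" by (simp add: extreme_point_of_def)
  have "z $ i = a $ i \<or> z $ i = b $ i" for i
  proof (rule ccontr)
    assume "\<not> (z $ i = a $ i \<or> z $ i = b $ i)"
    then have i: "a $ i < z $ i" "z $ i < b $ i"
      using zK by (auto simp: mem_box_cart le_less)
    \<comment> \<open>The distance to the nearer bound: both shifts by \<open>e\<close> stay in the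
      box and have \<open>z\<close> as midpoint.\<close>
    define e where "e = min (z $ i - a $ i) (b $ i - z $ i)"
    have e: "e > 0" "e \<le> z $ i - a $ i" "e \<le> b $ i - z $ i" using i by (auto simp: e_def)
    have "upd z i (z $ i - e) \<in> cbox a b" "upd z i (z $ i + e) \<in> cbox a b"
      using zK e by (auto simp: mem_box_cart upd_nth)
    moreover have "z \<in> open_segment (upd z i (z $ i - e)) (upd z i (z $ i + e))"
    proof -
      have "upd z i (z $ i - e) \<noteq> upd z i (z $ i + e)"
        using e by (metis add_diff_cancel_left' add_uminus_conv_diff neg_equal_zero order_less_irrefl upd_nth)
      moreover have "z = (1 - 1/2) *\<^sub>R upd z i (z $ i - e) + (1/2::real) *\<^sub>R upd z i (z $ i + e)"
        by (simp add: vec_eq_iff upd_nth field_simps)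
      ultimately show ?thesis
        unfolding in_segment(2) by (intro conjI exI[of _ "1/2"]) auto
    qed
    ultimately show False using z unfolding extreme_point_of_def by blast
  qed
  then show "z \<in> {z. \<forall>i. z $ i = a $ i \<or> z $ i = b $ i}" by blast
next
  fix z assume "z \<in> {z. \<forall>i. z $ i = a $ i \<or> z $ i = b $ i}"
  then have z: "z $ i = a $ i \<or> z $ i = b $ i" for i by blast
  have "z \<in> cbox a b"
    using z assms by (auto simp: mem_box_cart) (metis less_imp_le order_refl)+
  moreover have "z \<notin> open_segment x y" if "x \<in> cbox a b" "y \<in> cbox a b" for x y
  proof
    assume "z \<in> open_segment x y"
    then obtain u where u: "0 < u" "u < 1" "x \<noteq> y" "z = (1 - u) *\<^sub>R x + u *\<^sub>R y"
      unfolding in_segment(2) by blast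
    have "x $ i = y $ i" for i
    proof -
      have zi: "z $ i = (1 - u) * x $ i + u * y $ i" using u(4) by simp
      have xy: "a $ i \<le> x $ i" "x $ i \<le> b $ i" "a $ i \<le> y $ i" "y $ i \<le> b $ i"
        using that by (auto simp: mem_box_cart)
      show ?thesis using z[of i]
      proof
        assume "z $ i = a $ i"
        then have "(1 - u) * (x $ i - a $ i) + u * (y $ i - a $ i) = 0"
          using zi by (simp add: algebra_simps)
        moreover have "0 \<le> (1 - u) * (x $ i - a $ i)" "0 \<le> u * (y $ i - a $ i)" using xy u by auto
        ultimately have "(1 - u) * (x $ i - a $ i) = 0" "u * (y $ i - a $ i) = 0" by linarith+
        then show ?thesis using u by simp
      next
        assume "z $ i = b $ i"
        then have "(1 - u) * (b $ i - x $ i) + u * (b $ i - y $ i) = 0"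
          using zi by (simp add: algebra_simps)
        moreover have "0 \<le> (1 - u) * (b $ i - x $ i)" "0 \<le> u * (b $ i - y $ i)" using xy u by auto
        ultimately have "(1 - u) * (b $ i - x $ i) = 0" "u * (b $ i - y $ i) = 0" by linarith+
        then show ?thesis using u by simp
      qed
    qed
    then show False using u(3) by (simp add: vec_eq_iff)
  qed
  ultimately show "z \<in> vertices (cbox a b)"
    by (auto simp: vertices_def extreme_point_of_def)
qed

text \<open>Induction on the number of coordinates of \<open>x\<close> that are at neither bound:
  moving one of them to either bound lowers the number, and the two values obtained determine the
  value at \<open>x\<close>. The point \<open>x\<close> may lie outside the box.\<close>

lemma multiaffine_eq_on_cbox:
  fixes a b :: "real^'d"
  assumes ab: "\<And>i. a $ i < b $ i" and p: "multiaffine p" and q: "multiaffine q"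
    and eq: "\<And>z. z \<in> vertices (cbox a b) \<Longrightarrow> p z = q z"
  shows "p x = q x"
proof (induction "card {i. x $ i \<noteq> a $ i \<and> x $ i \<noteq> b $ i}" arbitrary: x rule: less_induct)
  case less
  show ?case
  proof (cases "\<exists>i. x $ i \<noteq> a $ i \<and> x $ i \<noteq> b $ i")
    case False
    then show ?thesis using eq[of x] vertices_cbox[OF ab] by blast
  next
    case True
    then obtain i where i: "x $ i \<noteq> a $ i" "x $ i \<noteq> b $ i" by blast
    have "p (upd x i s) = q (upd x i s)" if "s = a $ i \<or> s = b $ i" for s
    proof (rule less, rule psubset_card_mono)
      show "{j. upd x i s $ j \<noteq> a $ j \<and> upd x i s $ j \<noteq> b $ j} \<subset> {i. x $ i \<noteq> a $ i \<and> x $ i \<noteq> b $ i}"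
      proof
        show "{j. upd x i s $ j \<noteq> a $ j \<and> upd x i s $ j \<noteq> b $ j} \<subseteq> {i. x $ i \<noteq> a $ i \<and> x $ i \<noteq> b $ i}"
          using that i by (auto simp: upd_nth split: if_splits)
        have "i \<notin> {j. upd x i s $ j \<noteq> a $ j \<and> upd x i s $ j \<noteq> b $ j}"
          using that by (auto simp: upd_nth)
        then show "{j. upd x i s $ j \<noteq> a $ j \<and> upd x i s $ j \<noteq> b $ j} \<noteq> {i. x $ i \<noteq> a $ i \<and> x $ i \<noteq> b $ i}"
          using i by blast
      qed
    qed simp
    then show ?thesis
      using multiaffine_interpolate[OF p, of "a $ i" "b $ i" x i] multiaffine_interpolate[OF q, of "a $ i" "b $ i" x i] ab[of i]
      by simp
  qed
qed

lemma Q1_eq_on_cbox: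
  fixes a b :: "real^'d"
  assumes ab: "\<And>i. a $ i < b $ i" and "f \<in> Q1 (cbox a b)" "g \<in> Q1 (cbox a b)"
    and eq: "\<And>z. z \<in> vertices (cbox a b) \<Longrightarrow> f z = g z" and x: "x \<in> cbox a b"
  shows "f x = g x"
proof -
  obtain p where p: "multiaffine p" "\<And>x. x \<in> cbox a b \<Longrightarrow> f x = p x" using Q1_multiaffine assms(2) by blast
  obtain q where q: "multiaffine q" "\<And>x. x \<in> cbox a b \<Longrightarrow> g x = q x" using Q1_multiaffine assms(3) by blast
  have "vertices (cbox a b) \<subseteq> cbox a b" by (auto simp: vertices_def extreme_point_of_def)
  then show ?thesis
    using multiaffine_eq_on_cbox[OF ab p(1) q(1), of x] p(2) q(2) eq x by (metis subsetD)
qed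

text \<open>The one-sided derivative is that of the multiaffine extension \<open>p\<close>. It is
  unique because the box is nondegenerate in every direction.\<close>

lemma jacobian_Q1:
  fixes a b :: "real^'d" and v :: "real^'d \<Rightarrow> real^3"
  assumes ab: "\<And>i. a $ i < b $ i" and v: "\<And>j. (\<lambda>x. v x $ j) \<in> Q1 (cbox a b)"
    and z: "z \<in> vertices (cbox a b)"
  shows "jacobian v (at z within cbox a b) $ j $ i
    = (v (upd z i (b $ i)) - v (upd z i (a $ i))) $ j / (b $ i - a $ i)"
proof -
  have "\<exists>p. multiaffine p \<and> (\<forall>x\<in>cbox a b. v x $ j = p x)" for j
    using Q1_multiaffine[OF v[of j]] by metis
  then obtain p where p: "\<And>j. multiaffine (p j)" "\<And>j x. x \<in> cbox a b \<Longrightarrow> v x $ j = p j x"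
    by metis
  have zK: "z \<in> cbox a b" using z by (auto simp: vertices_def extreme_point_of_def)
  let ?D = "\<lambda>h. \<chi> j. frechet_derivative (p j) (at z) h"
  have "((\<lambda>x. \<chi> j. p j x) has_derivative ?D) (at z within cbox a b)"
  proof (rule has_derivative_at_withinI, subst has_derivative_componentwise_within, rule ballI)
    fix e :: "real^3" assume "e \<in> Basis"
    then obtain j where j: "e = axis j 1" by (auto simp: Basis_vec_def)
    have "(p j has_derivative frechet_derivative (p j) (at z)) (at z)"
      using p(1) frechet_derivative_works unfolding multiaffine_def by blast
    then show "((\<lambda>x. (\<chi> j. p j x) \<bullet> e) has_derivative (\<lambda>x. ?D x \<bullet> e)) (at z)"
      by (simp add: j inner_axis)
  qed
  then have D: "(v has_derivative ?D) (at z within cbox a b)"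
    by (rule has_derivative_transform[rotated 2]) (use zK p(2) in \<open>auto simp: vec_eq_iff\<close>)
  moreover have "(v has_derivative frechet_derivative v (at z within cbox a b)) (at z within cbox a b)"
    using D frechet_derivative_works unfolding differentiable_def by blast
  moreover have "a \<bullet> e < b \<bullet> e" if "e \<in> Basis" for e
    using that ab by (auto simp: Basis_vec_def inner_axis)
  ultimately have "frechet_derivative v (at z within cbox a b) = ?D"
    using frechet_derivative_unique_within_closed_interval[OF _ zK] by blast
  then have "jacobian v (at z within cbox a b) $ j $ i = frechet_derivative (p j) (at z) (axis i 1)"
    by (simp add: jacobian_def matrix_def)
  also have "\<dots> = (p j (upd z i (b $ i)) - p j (upd z i (a $ i))) / (b $ i - a $ i)"
    by (rule frechet_derivative_multiaffine[OF p(1)]) (use ab[of i] in auto)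
  also have "p j (upd z i (b $ i)) = v (upd z i (b $ i)) $ j"
    using zK ab by (subst p(2)) (auto simp: mem_box_cart upd_nth less_imp_le)
  also have "p j (upd z i (a $ i)) = v (upd z i (a $ i)) $ j"
    using zK ab by (subst p(2)) (auto simp: mem_box_cart upd_nth less_imp_le)
  finally show ?thesis by simp
qed

section \<open>Weak derivatives of Lipschitz functions\<close>

lemma lborel_integral_translation:
  fixes f :: "'a::euclidean_space \<Rightarrow> real"
  assumes "f \<in> borel_measurable borel"
  shows "(LINT x|lborel. f (c + x)) = (LINT x|lborel. f x)"
  using integral_distr[of "(+) c" lborel borel f] assms by (simp add: lborel_distr_plus)

lemma lborel_integrable_translation:
  fixes f :: "'a::euclidean_space \<Rightarrow> real"
  assumes "integrable lborel f"
  shows "integrable lborel (\<lambda>x. f (c + x))"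
  using integrable_distr[of "(+) c" lborel borel f] assms by (simp add: lborel_distr_plus)

lemma integrable_continuous_compact_support:
  fixes f :: "'a::euclidean_space \<Rightarrow> real"
  assumes "continuous_on UNIV f" "compact S" "\<And>x. x \<notin> S \<Longrightarrow> f x = 0"
  shows "integrable lborel f"
proof -
  have "integrable lborel (\<lambda>x. indicator S x *\<^sub>R f x)"
    by (rule borel_integrable_compact) (use assms in \<open>auto intro: continuous_on_subset\<close>)
  moreover have "(\<lambda>x. indicator S x *\<^sub>R f x) = f"
    using assms(3) by (auto simp: fun_eq_iff indicator_def)
  ultimately show ?thesis by simp
qed

lemma bounded_continuous_compact_support:
  fixes f :: "'a::euclidean_space \<Rightarrow> real"
  assumes "continuous_on UNIV f" "compact S" "\<And>x. x \<notin> S \<Longrightarrow> f x = 0"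
  obtains B where "B \<ge> 0" "\<And>x. \<bar>f x\<bar> \<le> B"
proof -
  have "bounded (f ` S)"
    using continuous_on_subset[OF assms(1) subset_UNIV] assms(2)
    by (intro compact_imp_bounded compact_continuous_image)
  then obtain B where B: "B > 0" "\<And>x. x \<in> S \<Longrightarrow> \<bar>f x\<bar> \<le> B"
    unfolding bounded_pos by auto
  have "\<bar>f x\<bar> \<le> B" for x using B assms(3)[of x] by (cases "x \<in> S") auto
  then show ?thesis using that[of B] B(1) by simp
qed

lemma integral_lebesgue_on_eq_lborel:
  fixes f :: "'a::euclidean_space \<Rightarrow> real"
  assumes "f \<in> borel_measurable borel" "\<Omega> \<in> sets lebesgue" "\<And>x. x \<notin> \<Omega> \<Longrightarrow> f x = 0"
  shows "(LINT x|lebesgue_on \<Omega>. f x) = (LINT x|lborel. f x)"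
proof -
  have "(LINT x|lebesgue_on \<Omega>. f x) = (LINT x|lebesgue. indicator \<Omega> x *\<^sub>R f x)"
    using assms(2) by (subst integral_restrict_space) auto
  also have "(\<lambda>x. indicator \<Omega> x *\<^sub>R f x) = f"
    using assms(3) by (auto simp: fun_eq_iff indicator_def)
  also have "(LINT x|lebesgue. f x) = (LINT x|lborel. f x)"
    using assms(1) by (intro integral_completion) simp
  finally show ?thesis .
qed

lemma test_functionD:
  fixes \<phi> :: "real^'d \<Rightarrow> real"
  assumes "\<phi> \<in> test_functions \<Omega>"
  obtains S where "compact S" "S \<subseteq> \<Omega>" "\<And>x. x \<notin> S \<Longrightarrow> \<phi> x = 0" "continuous_on UNIV \<phi>"
    "continuous_on UNIV (partial_deriv i \<phi>)" "\<And>x. x \<notin> S \<Longrightarrow> partial_deriv i \<phi> x = 0"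
    "\<And>x s. ((\<lambda>s. \<phi> (x + s *\<^sub>R axis i 1)) has_real_derivative partial_deriv i \<phi> (x + s *\<^sub>R axis i 1)) (at s)"
proof -
  define S where "S = closure {x. \<phi> x \<noteq> 0}"
  have S: "compact S" "S \<subseteq> \<Omega>" and cd: "cont_diff k \<phi>" for k
    using assms by (auto simp: test_functions_def S_def)
  have \<phi>0: "\<phi> x = 0" if "x \<notin> S" for x
    using that closure_subset[of "{x. \<phi> x \<noteq> 0}"] by (auto simp: S_def)
  have diff: "\<phi> differentiable (at x)" for x using cd[of "Suc 0"] by simp
  have cont: "continuous_on UNIV (partial_deriv i \<phi>)" using cd[of "Suc 0"] by simp
  have \<psi>0: "partial_deriv i \<phi> x = 0" if "x \<notin> S" for x
  proof -
    \<comment> \<open>The complement of the closed support is open, so the function is zero near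
      such a point.\<close>
    have "frechet_derivative (\<lambda>_. 0) (at x) = frechet_derivative \<phi> (at x)"
      by (rule frechet_derivative_transform_within_open[of _ x "- S"])
        (use that \<phi>0 S in \<open>auto intro: compact_imp_closed\<close>)
    then show ?thesis unfolding partial_deriv_def by (simp flip: \<open>_ = frechet_derivative \<phi> (at x)\<close>)
  qed
  have "((\<lambda>s. \<phi> (x + s *\<^sub>R axis i 1)) has_real_derivative partial_deriv i \<phi> (x + s *\<^sub>R axis i 1)) (at s)" for x s
  proof -
    let ?y = "x + s *\<^sub>R axis i 1"
    have D: "(\<phi> has_derivative frechet_derivative \<phi> (at ?y)) (at ?y)"
      using diff frechet_derivative_works by blast
    have "((\<lambda>s. x + s *\<^sub>R axis i 1) has_derivative (\<lambda>s. s *\<^sub>R axis i 1)) (at s)"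
      by (auto intro!: derivative_eq_intros)
    from has_derivative_compose[OF this D]
    have "((\<lambda>s. \<phi> (x + s *\<^sub>R axis i 1)) has_derivative (\<lambda>s. frechet_derivative \<phi> (at ?y) (s *\<^sub>R axis i 1))) (at s)" .
    moreover have "frechet_derivative \<phi> (at ?y) (s *\<^sub>R axis i 1) = s * partial_deriv i \<phi> ?y" for s
      using linear_cmul[OF has_derivative_linear[OF D]] by (simp add: partial_deriv_def)
    ultimately show ?thesis by (simp add: has_field_derivative_def mult.commute[of _ "partial_deriv i \<phi> ?y"])
  qed
  moreover have "continuous_on UNIV \<phi>"
    using diff differentiable_imp_continuous_within continuous_at_imp_continuous_on by blast
  ultimately show ?thesis using that[of S] S \<phi>0 \<psi>0 cont by blast
qed

text \<open>The difference quotients of \<open>w = U \<phi>\<close> in direction \<open>i\<close> have integral zero by translation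
  invariance; they are uniformly bounded with bounded support, so dominated convergence shows that
  \<open>\<partial>\<^sub>i w = U \<partial>\<^sub>i \<phi> + g \<phi>\<close> has integral zero too.\<close>
lemma weak_partial_Lipschitz:
  fixes U g :: "real^'d \<Rightarrow> real"
  assumes \<Omega>: "\<Omega> \<in> sets lebesgue" and U: "continuous_on UNIV U"
    and lip: "\<And>x s. \<bar>U (x + s *\<^sub>R axis i 1) - U x\<bar> \<le> C * \<bar>s\<bar>"
    and g: "g \<in> borel_measurable borel"
    and D: "AE x in lborel. ((\<lambda>s. U (x + s *\<^sub>R axis i 1)) has_real_derivative g x) (at 0)"
  shows "weak_partial \<Omega> i U g"
  unfolding weak_partial_def
proof
  fix \<phi> assume "\<phi> \<in> test_functions \<Omega>"
  define \<psi> where "\<psi> = partial_deriv i \<phi>"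
  obtain S where S: "compact S" "S \<subseteq> \<Omega>" and \<phi>0: "\<And>x. x \<notin> S \<Longrightarrow> \<phi> x = 0"
    and c\<phi>: "continuous_on UNIV \<phi>" and c\<psi>: "continuous_on UNIV \<psi>" and \<psi>0: "\<And>x. x \<notin> S \<Longrightarrow> \<psi> x = 0"
    and D\<phi>: "\<And>x s. ((\<lambda>s. \<phi> (x + s *\<^sub>R axis i 1)) has_real_derivative \<psi> (x + s *\<^sub>R axis i 1)) (at s)"
    unfolding \<psi>_def using test_functionD[OF \<open>\<phi> \<in> test_functions \<Omega>\<close>, of i] by metis
  obtain P where P: "P \<ge> 0" "\<And>x. \<bar>\<psi> x\<bar> \<le> P"
    using bounded_continuous_compact_support[OF c\<psi> S(1) \<psi>0] by blast
  obtain Q where Q: "Q \<ge> 0" "\<And>x. \<bar>\<phi> x\<bar> \<le> Q"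
    using bounded_continuous_compact_support[OF c\<phi> S(1) \<phi>0] by blast
  have lip\<phi>: "\<bar>\<phi> (x + s *\<^sub>R axis i 1) - \<phi> x\<bar> \<le> P * \<bar>s\<bar>" for x s
    using field_differentiable_bound[of UNIV "\<lambda>s. \<phi> (x + s *\<^sub>R axis i 1)" "\<lambda>s. \<psi> (x + s *\<^sub>R axis i 1)" P 0 s]
      D\<phi> P by (auto simp: has_field_derivative_at_within)
  obtain r where r: "S \<subseteq> cball 0 r" "r \<ge> 0"
    using bounded_subset_ballD[OF compact_imp_bounded[OF S(1)], of 0] ball_subset_cball by (metis less_imp_le subset_trans)
  \<comment> \<open>Shifts have length at most 1. The difference quotient vanishes unless
    \<open>x\<close> is in the ball of radius \<open>r + 1\<close>, and then the shifted point is in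
    the ball of radius \<open>r + 2\<close>.\<close>
  have "bounded (U ` cball 0 (r + 2))"
    using U by (intro compact_imp_bounded compact_continuous_image) (auto intro: continuous_on_subset)
  then obtain R where R: "R > 0" "\<And>x. x \<in> cball 0 (r + 2) \<Longrightarrow> \<bar>U x\<bar> \<le> R"
    unfolding bounded_pos by auto
  have C: "C \<ge> 0" using lip[of 0 1] by simp
  define w where "w = (\<lambda>x. U x * \<phi> x)"
  have cw: "continuous_on UNIV w" unfolding w_def by (intro continuous_intros U c\<phi>)
  have w0: "w x = 0" if "x \<notin> S" for x using \<phi>0[OF that] by (simp add: w_def)
  have iw: "integrable lborel w" by (rule integrable_continuous_compact_support[OF cw S(1) w0])
  have [measurable]: "U \<in> borel_measurable borel" "\<phi> \<in> borel_measurable borel" "\<psi> \<in> borel_measurable borel"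
      "w \<in> borel_measurable borel"
    using U c\<phi> c\<psi> cw by (auto intro: borel_measurable_continuous_onI)
  note g[measurable]
  define h where "h n = inverse (real (Suc n))" for n
  have h: "0 < h n" "h n \<le> 1" "h \<longlonglongrightarrow> 0" for n
    unfolding h_def using LIMSEQ_inverse_real_of_nat by (auto simp: inverse_le_1_iff)
  define W where "W n x = (w (h n *\<^sub>R axis i 1 + x) - w x) / h n" for n x
  have "(LINT x|lborel. W n x) = 0" for n
    unfolding W_def using iw lborel_integrable_translation[OF iw] lborel_integral_translation[of w] by simp
  moreover have "(\<lambda>n. LINT x|lborel. W n x) \<longlonglongrightarrow> (LINT x|lborel. U x * \<psi> x + g x * \<phi> x)"
    and intD: "integrable lborel (\<lambda>x. U x * \<psi> x + g x * \<phi> x)"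
  proof -
    \<comment> \<open>The discrete product rule gives the constant: \<open>R\<close> bounds
      \<open>U\<close>, \<open>P\<close> is the Lipschitz constant of \<phi>, \<open>Q\<close>
      bounds \<phi>, and \<open>C\<close> is the Lipschitz constant of \<open>U\<close>.\<close>
    let ?w = "\<lambda>x. (R * P + Q * C) * indicator (cball 0 (r + 1)) x :: real"
    have lim: "AE x in lborel. (\<lambda>n. W n x) \<longlonglongrightarrow> U x * \<psi> x + g x * \<phi> x"
      using D
    proof eventually_elim
      case (elim x)
      have "((\<lambda>s. w (x + s *\<^sub>R axis i 1)) has_real_derivative U x * \<psi> x + g x * \<phi> x) (at 0)"
        unfolding w_def using DERIV_mult[OF elim D\<phi>[of x 0]] by (simp add: algebra_simps)
      then have "((\<lambda>s. (w (x + s *\<^sub>R axis i 1) - w x) / s) \<longlongrightarrow> U x * \<psi> x + g x * \<phi> x) (at 0)"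
        unfolding DERIV_def by simp
      moreover have "filterlim h (at 0) sequentially"
        using h by (auto simp: filterlim_at less_imp_neq[symmetric] intro!: always_eventually)
      ultimately show ?case
        unfolding W_def by (auto dest: filterlim_compose simp: add.commute)
    qed
    have bound: "AE x in lborel. norm (W n x) \<le> ?w x" for n
    proof (rule AE_I2)
      fix x :: "real^'d"
      let ?y = "x + h n *\<^sub>R axis i 1"
      have xy: "norm ?y \<le> norm x + 1" "norm x \<le> norm ?y + 1"
      proof -
        have "norm (h n *\<^sub>R axis i 1 :: real^'d) \<le> 1" using h(1,2)[of n] by (simp add: norm_axis_1)
        then show "norm ?y \<le> norm x + 1" "norm x \<le> norm ?y + 1"
          using norm_triangle_ineq[of x "h n *\<^sub>R axis i 1"] norm_triangle_ineq4[of ?y "h n *\<^sub>R axis i 1"]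
          by simp_all
      qed
      show "norm (W n x) \<le> ?w x"
      proof (cases "x \<in> cball 0 (r + 1)")
        case True
        have "w ?y - w x = U ?y * (\<phi> ?y - \<phi> x) + \<phi> x * (U ?y - U x)"
          by (simp add: w_def algebra_simps)
        also have "\<bar>\<dots>\<bar> \<le> \<bar>U ?y\<bar> * \<bar>\<phi> ?y - \<phi> x\<bar> + \<bar>\<phi> x\<bar> * \<bar>U ?y - U x\<bar>"
          by (metis abs_mult abs_triangle_ineq)
        also have "\<dots> \<le> R * (P * \<bar>h n\<bar>) + Q * (C * \<bar>h n\<bar>)"
        proof (intro add_mono mult_mono lip lip\<phi> Q)
          show "\<bar>U ?y\<bar> \<le> R" using True xy(1) by (intro R(2)) simp
        qed (use R(1) Q in auto)
        also have "\<dots> = (R * P + Q * C) * h n" using h(1)[of n] by (simp add: algebra_simps)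
        finally show ?thesis
          using True h(1)[of n] by (simp add: W_def add.commute divide_le_eq)
      next
        case False
        then have "x \<notin> S" "?y \<notin> S" using xy r by (auto simp: subset_iff)
        then show ?thesis using w0 False by (simp add: W_def add.commute)
      qed
    qed
    have int: "integrable lborel ?w"
      by (intro integrable_mult_right integrable_real_indicator) (simp_all add: emeasure_bounded_finite[unfolded infinity_ennreal_def])
    have meas: "(\<lambda>x. U x * \<psi> x + g x * \<phi> x) \<in> borel_measurable lborel" "\<And>n. W n \<in> borel_measurable lborel"
      unfolding W_def by measurable
    show "(\<lambda>n. LINT x|lborel. W n x) \<longlonglongrightarrow> (LINT x|lborel. U x * \<psi> x + g x * \<phi> x)"
      by (rule integral_dominated_convergence[OF meas int lim bound])
    show "integrable lborel (\<lambda>x. U x * \<psi> x + g x * \<phi> x)"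
      by (rule integrable_dominated_convergence[OF meas int lim bound])
  qed
  ultimately have I0: "(LINT x|lborel. U x * \<psi> x + g x * \<phi> x) = 0"
    by (simp add: LIMSEQ_const_iff)
  have i1: "integrable lborel (\<lambda>x. U x * \<psi> x)"
    by (rule integrable_continuous_compact_support[OF _ S(1)])
      (use \<psi>0 in \<open>auto intro!: continuous_intros U c\<psi>\<close>)
  \<comment> \<open>Integrability of this term is inherited from the dominated limit, by subtracting
    the continuous term.\<close>
  have i2: "integrable lborel (\<lambda>x. g x * \<phi> x)"
    using Bochner_Integration.integrable_diff[OF intD i1] by simp
  have "(LINT x|lebesgue_on \<Omega>. U x * \<psi> x) = (LINT x|lborel. U x * \<psi> x)"
    using \<psi>0 S(2) by (intro integral_lebesgue_on_eq_lborel \<Omega>) auto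
  moreover have "(LINT x|lebesgue_on \<Omega>. g x * \<phi> x) = (LINT x|lborel. g x * \<phi> x)"
    using \<phi>0 S(2) by (intro integral_lebesgue_on_eq_lborel \<Omega>) auto
  ultimately show "(LINT x|lebesgue_on \<Omega>. U x * partial_deriv i \<phi> x) = - (LINT x|lebesgue_on \<Omega>. g x * \<phi> x)"
    using I0 i1 i2 by (simp add: \<psi>_def)
qed

lemma L2_bounded:
  fixes f :: "real^'d \<Rightarrow> real"
  assumes "\<Omega> \<in> lmeasurable" "f \<in> borel_measurable borel" "\<And>x. x \<in> \<Omega> \<Longrightarrow> \<bar>f x\<bar> \<le> B"
  shows "f \<in> L2 \<Omega>"
proof -
  have [measurable]: "f \<in> borel_measurable (lebesgue_on \<Omega>)"
    using assms(2) by (intro measurable_restrict_space1 measurable_completion) simp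
  interpret finite_measure "lebesgue_on \<Omega>"
    using assms(1) by (rule finite_measure_lebesgue_on)
  have "integrable (lebesgue_on \<Omega>) (\<lambda>x. (f x)\<^sup>2)"
  proof (rule integrable_const_bound[of _ "B\<^sup>2"])
    have "norm ((f x)\<^sup>2) \<le> B\<^sup>2" if "x \<in> \<Omega>" for x
    proof -
      have "\<bar>f x\<bar> \<le> \<bar>B\<bar>" using assms(3)[OF that] by linarith
      then show ?thesis using abs_le_square_iff[of "f x" B] by simp
    qed
    then show "AE x in lebesgue_on \<Omega>. norm ((f x)\<^sup>2) \<le> B\<^sup>2"
      by (intro AE_I2) (simp add: space_restrict_space)
  qed measurable
  then show ?thesis by (simp add: L2_def)
qed

text \<open>An element of \<open>Sh\<close> is extended by zero and may jump at the boundary. Hence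
  the Lipschitz data are those of a function \<open>U\<close> on the whole space that agrees with
  \<open>v\<close> on \<Omega>; the conditions in \<open>H1\<close> see only \<Omega>.\<close>

lemma H1_Lipschitz:
  fixes U v :: "real^'d \<Rightarrow> real"
  assumes \<Omega>: "open \<Omega>" "bounded \<Omega>" and U: "continuous_on UNIV U"
    and lip: "\<And>i x s. \<bar>U (x + s *\<^sub>R axis i 1) - U x\<bar> \<le> C * \<bar>s\<bar>"
    and g: "\<And>i. g i \<in> borel_measurable borel" "\<And>i x. \<bar>g i x\<bar> \<le> C"
    and D: "\<And>i. AE x in lborel. ((\<lambda>s. U (x + s *\<^sub>R axis i 1)) has_real_derivative g i x) (at 0)"
    and v: "\<And>x. x \<in> \<Omega> \<Longrightarrow> v x = U x"
  shows "v \<in> H1 \<Omega>"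
proof -
  have m: "\<Omega> \<in> lmeasurable" using \<Omega> by (simp add: lmeasurable_open)
  have "bounded (U ` closure \<Omega>)"
    using U \<Omega>(2) by (intro compact_imp_bounded compact_continuous_image) (auto intro: continuous_on_subset)
  then obtain B where "\<And>x. x \<in> closure \<Omega> \<Longrightarrow> \<bar>U x\<bar> \<le> B"
    unfolding bounded_iff by auto
  then have "U \<in> L2 \<Omega>"
    using U closure_subset by (intro L2_bounded[OF m]) (auto intro: borel_measurable_continuous_onI)
  moreover have "\<exists>g\<in>L2 \<Omega>. weak_partial \<Omega> i U g" for i
    using L2_bounded[OF m g(1)[of i] g(2)] weak_partial_Lipschitz[OF _ U lip g(1) D] m
    by (blast intro: fmeasurableD)
  ultimately have "U \<in> H1 \<Omega>" by (simp add: H1_def)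
  moreover have "v \<in> L2 \<Omega> \<longleftrightarrow> U \<in> L2 \<Omega>"
  proof -
    have "v \<in> borel_measurable (lebesgue_on \<Omega>) \<longleftrightarrow> U \<in> borel_measurable (lebesgue_on \<Omega>)"
      using v by (intro measurable_cong) simp
    moreover have "integrable (lebesgue_on \<Omega>) (\<lambda>x. (v x)\<^sup>2) \<longleftrightarrow> integrable (lebesgue_on \<Omega>) (\<lambda>x. (U x)\<^sup>2)"
      using v by (intro Bochner_Integration.integrable_cong) auto
    ultimately show ?thesis by (simp add: L2_def)
  qed
  moreover have "weak_partial \<Omega> i v h \<longleftrightarrow> weak_partial \<Omega> i U h" for i h
  proof -
    have "(LINT x|lebesgue_on \<Omega>. v x * h x) = (LINT x|lebesgue_on \<Omega>. U x * h x)" for h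
      using v by (intro Bochner_Integration.integral_cong) auto
    then show ?thesis by (simp add: weak_partial_def)
  qed
  ultimately show ?thesis by (simp add: H1_def)
qed

section \<open>Hat functions and nodal interpolation\<close>

lemma interval_partition_strict_mono:
  assumes "interval_partition \<alpha> \<beta> M t" "i < j" "j \<le> M"
  shows "t i < t j"
  using assms(2,3)
proof (induction j)
  case (Suc j)
  have "t j < t (Suc j)" using assms(1) Suc.prems unfolding interval_partition_def by simp
  then show ?case using Suc by (cases "i = j") auto
qed simp

lemma interval_partition_mono:
  assumes "interval_partition \<alpha> \<beta> M t" "i \<le> j" "j \<le> M"
  shows "t i \<le> t j"
  using interval_partition_strict_mono[OF assms(1), of i j] assms(2,3) by (cases "i = j") auto

text \<open>The cell ends at the first break point that is at least \<open>s\<close>; if that is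
  already \<open>t 0\<close>, the first cell serves.\<close>

lemma interval_partition_cover:
  assumes "interval_partition \<alpha> \<beta> M t" "\<alpha> < \<beta>" "\<alpha> \<le> s" "s \<le> \<beta>"
  obtains k where "k < M" "t k \<le> s" "s \<le> t (Suc k)"
proof -
  have t: "t 0 = \<alpha>" "t M = \<beta>" using assms(1) by (auto simp: interval_partition_def)
  define l where "l = (LEAST l. s \<le> t l)"
  have l: "s \<le> t l" "\<And>k. s \<le> t k \<Longrightarrow> l \<le> k"
    unfolding l_def using assms(4) t(2) by (metis LeastI, metis Least_le)
  have "M \<noteq> 0" using t assms(2) by (metis order_less_irrefl)
  show ?thesis
  proof (cases l)
    case 0
    have "t 0 < t (Suc 0)" using interval_partition_strict_mono[OF assms(1), of 0 "Suc 0"] \<open>M \<noteq> 0\<close> by simp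
    then show ?thesis using that[of 0] \<open>M \<noteq> 0\<close> l(1) 0 assms(3) t(1) by simp
  next
    case (Suc k)
    have "k < M" using l(2)[of M] assms(4) t(2) Suc by simp
    moreover have "\<not> s \<le> t k" using l(2)[of k] Suc by auto
    ultimately show ?thesis using that[of k] l(1) Suc by simp
  qed
qed

definition ramp :: "real \<Rightarrow> real \<Rightarrow> real \<Rightarrow> real" where
  "ramp p q s = max 0 (min 1 ((s - p) / (q - p)))"

text \<open>The value 0 at the kinks \<open>p\<close> and \<open>q\<close> is a convention; they are
  excluded almost everywhere.\<close>

definition ramp_deriv :: "real \<Rightarrow> real \<Rightarrow> real \<Rightarrow> real" where
  "ramp_deriv p q s = (if p < s \<and> s < q then 1 / (q - p) else 0)"

lemma ramp_simps:
  assumes "p < q"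
  shows "s \<le> p \<Longrightarrow> ramp p q s = 0" "q \<le> s \<Longrightarrow> ramp p q s = 1"
    "p \<le> s \<Longrightarrow> s \<le> q \<Longrightarrow> ramp p q s = (s - p) / (q - p)"
  using assms by (auto simp: ramp_def field_simps max_def min_def)

lemma ramp_bounds: "0 \<le> ramp p q s" "ramp p q s \<le> 1"
  by (auto simp: ramp_def)

lemma ramp_Lipschitz:
  assumes "p < q"
  shows "\<bar>ramp p q s - ramp p q s'\<bar> \<le> 1 / (q - p) * \<bar>s - s'\<bar>"
proof -
  have "\<bar>ramp p q s - ramp p q s'\<bar> \<le> \<bar>(s - p) / (q - p) - (s' - p) / (q - p)\<bar>"
    by (auto simp: ramp_def max_def min_def)
  also have "\<dots> = 1 / (q - p) * \<bar>s - s'\<bar>"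
    using assms by (simp add: abs_mult abs_divide flip: diff_divide_distrib)
  finally show ?thesis .
qed

lemma ramp_has_derivative:
  assumes "p < q" "s \<noteq> p" "s \<noteq> q"
  shows "(ramp p q has_real_derivative ramp_deriv p q s) (at s)"
proof -
  consider "s < p" | "p < s" "s < q" | "q < s" using assms by linarith
  then show ?thesis
  proof cases
    case 1
    have "((\<lambda>_. 0) has_real_derivative 0) (at s)" by simp
    then show ?thesis
      by (rule has_field_derivative_transform_within_open[of _ _ _ "{..<p}", THEN DERIV_cong])
        (use 1 assms in \<open>auto simp: ramp_simps ramp_deriv_def\<close>)
  next
    case 2
    have "((\<lambda>s. (s - p) / (q - p)) has_real_derivative 1 / (q - p)) (at s)"
      using assms(1) by (auto intro!: derivative_eq_intros)
    then show ?thesis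
      by (rule has_field_derivative_transform_within_open[of _ _ _ "{p<..<q}", THEN DERIV_cong])
        (use 2 assms in \<open>auto simp: ramp_simps ramp_deriv_def\<close>)
  next
    case 3
    have "((\<lambda>_. 1) has_real_derivative 0) (at s)" by simp
    then show ?thesis
      by (rule has_field_derivative_transform_within_open[of _ _ _ "{q<..}", THEN DERIV_cong])
        (use 3 assms in \<open>auto simp: ramp_simps ramp_deriv_def\<close>)
  qed
qed

text \<open>Writing the hat functions as differences of ramps treats the two boundary nodes, where only one of
  the two ramps is present, on the same footing as the interior ones.\<close>
definition hat :: "(nat \<Rightarrow> real) \<Rightarrow> nat \<Rightarrow> nat \<Rightarrow> real \<Rightarrow> real" where
  "hat t M k s = (if k = 0 then 1 else ramp (t (k - 1)) (t k) s) - (if k = M then 0 else ramp (t k) (t (Suc k)) s)"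

definition hat_deriv :: "(nat \<Rightarrow> real) \<Rightarrow> nat \<Rightarrow> nat \<Rightarrow> real \<Rightarrow> real" where
  "hat_deriv t M k s = (if k = 0 then 0 else ramp_deriv (t (k - 1)) (t k) s) - (if k = M then 0 else ramp_deriv (t k) (t (Suc k)) s)"

lemma hat_bounded: "\<bar>hat t M k s\<bar> \<le> 1"
  using ramp_bounds[of "t (k - 1)" "t k" s] ramp_bounds[of "t k" "t (Suc k)" s] by (auto simp: hat_def)

lemma continuous_on_hat: "continuous_on UNIV (hat t M k)"
  unfolding hat_def[abs_def] ramp_def divide_inverse
  by (cases "k = 0"; cases "k = M") (auto intro!: continuous_intros)

lemma borel_measurable_hat_deriv [measurable]: "hat_deriv t M k \<in> borel_measurable borel"
  unfolding hat_deriv_def[abs_def] ramp_deriv_def by measurable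

context
  fixes \<alpha> \<beta> :: real and M :: nat and t :: "nat \<Rightarrow> real"
  assumes part: "interval_partition \<alpha> \<beta> M t"
begin

lemma partition_step: "k \<le> M \<Longrightarrow> k \<noteq> 0 \<Longrightarrow> t (k - 1) < t k" "k \<le> M \<Longrightarrow> k \<noteq> M \<Longrightarrow> t k < t (Suc k)"
  using interval_partition_strict_mono[OF part] by auto

text \<open>A single constant bounds both the increments and the derivative, as
  \<open>H1_Lipschitz\<close> expects. Each of the two summands of a hat is a constant or a ramp,
  and the constants add up.\<close>

lemma hat_Lipschitz:
  assumes "k \<le> M"
  shows "\<exists>C. (\<forall>s s'. \<bar>hat t M k s - hat t M k s'\<bar> \<le> C * \<bar>s - s'\<bar>) \<and> (\<forall>s. \<bar>hat_deriv t M k s\<bar> \<le> C)"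
proof -
  have 1: "\<exists>C. (\<forall>s s'. \<bar>f s - f s'\<bar> \<le> C * \<bar>s - s'\<bar>) \<and> (\<forall>s. \<bar>f' s\<bar> \<le> C)"
    if "f = (\<lambda>_. c) \<and> f' = (\<lambda>_. 0) \<or> (\<exists>p q. p < q \<and> f = ramp p q \<and> f' = ramp_deriv p q)" for f f' :: "real \<Rightarrow> real" and c :: real
    using that
  proof
    assume "f = (\<lambda>_. c) \<and> f' = (\<lambda>_. 0)"
    then show ?thesis by (intro exI[of _ 0]) auto
  next
    assume "\<exists>p q. p < q \<and> f = ramp p q \<and> f' = ramp_deriv p q"
    then obtain p q where *: "p < q" "f = ramp p q" "f' = ramp_deriv p q" by blast
    then show ?thesis
      using ramp_Lipschitz[OF *(1)] by (intro exI[of _ "1 / (q - p)"]) (auto simp: ramp_deriv_def)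
  qed
  let ?f = "\<lambda>s. if k = 0 then 1 else ramp (t (k - 1)) (t k) s"
  let ?f' = "\<lambda>s. if k = 0 then 0 else ramp_deriv (t (k - 1)) (t k) s"
  let ?g = "\<lambda>s. if k = M then 0 else ramp (t k) (t (Suc k)) s"
  let ?g' = "\<lambda>s. if k = M then 0 else ramp_deriv (t k) (t (Suc k)) s"
  have "?f = (\<lambda>_. 1) \<and> ?f' = (\<lambda>_. 0) \<or> (\<exists>p q. p < q \<and> ?f = ramp p q \<and> ?f' = ramp_deriv p q)"
    using partition_step(1)[OF assms] by (cases "k = 0") auto
  from 1[OF this] obtain C where C: "\<And>s s'. \<bar>?f s - ?f s'\<bar> \<le> C * \<bar>s - s'\<bar>" "\<And>s. \<bar>?f' s\<bar> \<le> C" by blast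
  have "?g = (\<lambda>_. 0) \<and> ?g' = (\<lambda>_. 0) \<or> (\<exists>p q. p < q \<and> ?g = ramp p q \<and> ?g' = ramp_deriv p q)"
    using partition_step(2)[OF assms] by (cases "k = M") auto
  from 1[OF this] obtain D where D: "\<And>s s'. \<bar>?g s - ?g s'\<bar> \<le> D * \<bar>s - s'\<bar>" "\<And>s. \<bar>?g' s\<bar> \<le> D" by blast
  have hat: "hat t M k = (\<lambda>s. ?f s - ?g s)" "hat_deriv t M k = (\<lambda>s. ?f' s - ?g' s)"
    by (simp_all add: fun_eq_iff hat_def hat_deriv_def)
  show ?thesis
  proof (intro exI[of _ "C + D"] conjI allI)
    fix s s'
    have "\<bar>(?f s - ?g s) - (?f s' - ?g s')\<bar> \<le> \<bar>?f s - ?f s'\<bar> + \<bar>?g s - ?g s'\<bar>" by linarith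
    also have "\<dots> \<le> (C + D) * \<bar>s - s'\<bar>" using C(1)[of s s'] D(1)[of s s'] unfolding distrib_right by linarith
    finally show "\<bar>hat t M k s - hat t M k s'\<bar> \<le> (C + D) * \<bar>s - s'\<bar>" unfolding hat .
    have "\<bar>?f' s - ?g' s\<bar> \<le> \<bar>?f' s\<bar> + \<bar>?g' s\<bar>" by linarith
    also have "\<dots> \<le> C + D" using C(2)[of s] D(2)[of s] by linarith
    finally show "\<bar>hat_deriv t M k s\<bar> \<le> C + D" unfolding hat .
  qed
qed

lemma hat_has_derivative:
  assumes "k \<le> M" "s \<notin> t ` {..M}"
  shows "(hat t M k has_real_derivative hat_deriv t M k s) (at s)"
proof -
  have ne: "s \<noteq> t l" if "l \<le> M" for l using assms(2) that by blast
  have "((\<lambda>s. if k = 0 then 1 else ramp (t (k - 1)) (t k) s) has_real_derivative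
      (if k = 0 then 0 else ramp_deriv (t (k - 1)) (t k) s)) (at s)"
    using ramp_has_derivative[OF partition_step(1)[OF assms(1)], of s] ne[of k] ne[of "k - 1"] assms(1)
    by (cases "k = 0") simp_all
  moreover have "((\<lambda>s. if k = M then 0 else ramp (t k) (t (Suc k)) s) has_real_derivative
      (if k = M then 0 else ramp_deriv (t k) (t (Suc k)) s)) (at s)"
    using ramp_has_derivative[OF partition_step(2)[OF assms(1)], of s] ne[of k] ne[of "Suc k"] assms(1)
    by (cases "k = M") simp_all
  ultimately show ?thesis
    unfolding hat_def[abs_def] hat_deriv_def by (rule DERIV_diff)
qed

text \<open>Kinks occur at break points only: on a given cell each ramp is constantly 0, constantly
  1, or on its sloping piece.\<close>

lemma hat_affine:
  assumes k: "k \<le> M" and j: "j < M"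
  shows "\<exists>A B. \<forall>s. t j \<le> s \<and> s \<le> t (Suc j) \<longrightarrow> hat t M k s = A + B * s"
proof -
  have ramp: "\<exists>A B. \<forall>s. t j \<le> s \<and> s \<le> t (Suc j) \<longrightarrow> ramp (t l) (t (Suc l)) s = A + B * s" if l: "l < M" for l
  proof -
    have lt: "t l < t (Suc l)" using partition_step(2)[of l] l by simp
    consider "Suc j \<le> l" | "l = j" | "Suc l \<le> j" by linarith
    then show ?thesis
    proof cases
      case 1
      then have "t (Suc j) \<le> t l" using interval_partition_mono[OF part] l by simp
      then show ?thesis using ramp_simps(1)[OF lt] by (intro exI[of _ 0]) auto
    next
      case 2
      have "(s - t j) / (t (Suc j) - t j) = - t j / (t (Suc j) - t j) + 1 / (t (Suc j) - t j) * s" for s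
        by (simp add: diff_divide_distrib)
      then show ?thesis using ramp_simps(3)[OF lt] 2 by metis
    next
      case 3
      then have "t (Suc l) \<le> t j" using interval_partition_mono[OF part] j by simp
      then show ?thesis using ramp_simps(2)[OF lt] by (intro exI[of _ 1] exI[of _ 0]) auto
    qed
  qed
  have c: "\<exists>A B. \<forall>s. t j \<le> s \<and> s \<le> t (Suc j) \<longrightarrow> (c::real) = A + B * s" for c
    by (intro exI[of _ c] exI[of _ 0]) simp
  have "\<exists>A B. \<forall>s. t j \<le> s \<and> s \<le> t (Suc j) \<longrightarrow> (if k = 0 then 1 else ramp (t (k - 1)) (t k) s) = A + B * s"
    using ramp[of "k - 1"] c[of 1] k by (cases "k = 0") simp_all
  then obtain A B where AB: "\<And>s. t j \<le> s \<Longrightarrow> s \<le> t (Suc j) \<Longrightarrow> (if k = 0 then 1 else ramp (t (k - 1)) (t k) s) = A + B * s"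
    by blast
  have "\<exists>A B. \<forall>s. t j \<le> s \<and> s \<le> t (Suc j) \<longrightarrow> (if k = M then 0 else ramp (t k) (t (Suc k)) s) = A + B * s"
    using ramp[of k] c[of 0] k by (cases "k = M") simp_all
  then obtain A' B' where AB': "\<And>s. t j \<le> s \<Longrightarrow> s \<le> t (Suc j) \<Longrightarrow> (if k = M then 0 else ramp (t k) (t (Suc k)) s) = A' + B' * s"
    by blast
  show ?thesis
  proof (intro exI allI impI, elim conjE)
    fix s assume "t j \<le> s" "s \<le> t (Suc j)"
    then show "hat t M k s = (A - A') + (B - B') * s"
      using AB AB' unfolding hat_def by (simp add: algebra_simps)
  qed
qed

text \<open>The ramp over cell \<open>i\<close> has the value \<open>of_bool (i < l)\<close> at node
  \<open>l\<close>, so the difference of two consecutive ramps leaves only the node between their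
  cells.\<close>

lemma hat_node:
  assumes "k \<le> M" "l \<le> M"
  shows "hat t M k (t l) = of_bool (k = l)"
proof -
  have r: "ramp (t i) (t (Suc i)) (t l) = of_bool (i < l)" if "i < M" for i
  proof -
    have lt: "t i < t (Suc i)" using partition_step(2)[of i] that by simp
    show ?thesis
      using ramp_simps(1,2)[OF lt, of "t l"] interval_partition_mono[OF part, of l i] interval_partition_mono[OF part, of "Suc i" l] that assms(2)
      by (cases "i < l") auto
  qed
  show ?thesis
    using r[of "k - 1"] r[of k] assms by (auto simp: hat_def)
qed

end

text \<open>Hyperplanes are null sets; this removes the kinks of the hat functions.\<close>

lemma AE_lborel_coordinate_neq:
  fixes i :: "'d::finite"
  shows "AE x in (lborel :: (real^'d) measure). x $ i \<noteq> c"
proof -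
  have m: "{x :: real^'d. x $ i = c} \<in> sets lborel" by simp
  have "{x :: real^'d. x $ i = c} \<in> null_sets lborel"
    using negligible_standard_hyperplane[of "axis i 1 :: real^'d" c] m
    by (simp add: negligible_iff_null_sets null_sets_completion_iff inner_axis axis_in_Basis_iff)
  from AE_not_in[OF this] show ?thesis by simp
qed

section \<open>A fixed tensor-product mesh: nodal values parametrise the finite element
  space\<close>

locale cart_mesh =
  fixes \<Omega> :: "(real^'d) set" and a b :: "real^'d" and M :: "'d \<Rightarrow> nat" and t :: "'d \<Rightarrow> nat \<Rightarrow> real"
    and Th :: "(real^'d) set set"
  assumes ab: "a $ i < b $ i" and \<Omega>: "\<Omega> = box a b"
    and part: "interval_partition (a $ i) (b $ i) (M i) (t i)"
    and Th: "Th = {cbox (\<chi> i. t i (k i)) (\<chi> i. t i (Suc (k i))) | k. \<forall>i. k i < M i}"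
begin

lemma box_nonempty: "box a b \<noteq> {}"
  using ab by (auto simp: box_ne_empty Basis_vec_def inner_axis)

lemma closure_\<Omega>: "closure \<Omega> = cbox a b"
  unfolding \<Omega> using closure_box[OF box_nonempty] .

lemma finite_multi_index: "finite {k. \<forall>i. k i \<le> M i}"
proof -
  have "{k. \<forall>i. k i \<le> M i} = Pi\<^sub>E UNIV (\<lambda>i. {..M i})" by auto
  then show ?thesis by (simp add: finite_PiE)
qed

lemma finite_Th: "finite Th"
proof -
  have "Th \<subseteq> (\<lambda>k. cbox (\<chi> i. t i (k i)) (\<chi> i. t i (Suc (k i)))) ` {k. \<forall>i. k i \<le> M i}"
    unfolding Th by (auto intro: less_imp_le)
  then show ?thesis by (rule finite_surj[OF finite_multi_index])
qed

lemma cell: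
  assumes "K \<in> Th"
  obtains k where "\<And>i. k i < M i" "K = cbox (\<chi> i. t i (k i)) (\<chi> i. t i (Suc (k i)))"
    "\<And>i. (\<chi> i. t i (k i)) $ i < (\<chi> i. t i (Suc (k i))) $ i"
proof -
  obtain k where k: "\<And>i. k i < M i" "K = cbox (\<chi> i. t i (k i)) (\<chi> i. t i (Suc (k i)))"
    using assms unfolding Th by blast
  have "t i (k i) < t i (Suc (k i))" for i
    by (rule interval_partition_strict_mono[OF part]) (use k(1)[of i] in auto)
  then show ?thesis using that[OF k] by simp
qed

lemma closure_\<Omega>_eq_Union: "closure \<Omega> = \<Union>Th"
proof (intro set_eqI iffI)
  fix x assume "x \<in> closure \<Omega>"
  then have x: "a $ i \<le> x $ i" "x $ i \<le> b $ i" for i by (auto simp: closure_\<Omega> mem_box_cart)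
  have "\<exists>k<M i. t i k \<le> x $ i \<and> x $ i \<le> t i (Suc k)" for i
    using interval_partition_cover[OF part ab x] by metis
  then obtain k where "\<And>i. k i < M i \<and> t i (k i) \<le> x $ i \<and> x $ i \<le> t i (Suc (k i))" by metis
  then have "x \<in> cbox (\<chi> i. t i (k i)) (\<chi> i. t i (Suc (k i)))" "\<forall>i. k i < M i"
    by (auto simp: mem_box_cart)
  then show "x \<in> \<Union>Th" unfolding Th by blast
next
  fix x assume "x \<in> \<Union>Th"
  then obtain K where K: "K \<in> Th" "x \<in> K" by blast
  then obtain k where k: "\<And>i. k i < M i" "K = cbox (\<chi> i. t i (k i)) (\<chi> i. t i (Suc (k i)))" by (metis cell)
  have "a $ i \<le> x $ i \<and> x $ i \<le> b $ i" for i
  proof -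
    have "t i 0 = a $ i" "t i (M i) = b $ i" using part by (auto simp: interval_partition_def)
    moreover have "t i 0 \<le> t i (k i)" "t i (Suc (k i)) \<le> t i (M i)"
      using interval_partition_mono[OF part] k(1)[of i] by simp_all
    moreover have "t i (k i) \<le> x $ i" "x $ i \<le> t i (Suc (k i))" using K(2) k(2) by (auto simp: mem_box_cart)
    ultimately show ?thesis by linarith
  qed
  then show "x \<in> closure \<Omega>" by (auto simp: closure_\<Omega> mem_box_cart)
qed

definition grid_point :: "('d \<Rightarrow> nat) \<Rightarrow> real^'d" where
  "grid_point k = (\<chi> i. t i (k i))"

lemma nodes_grid_point:
  assumes "z \<in> nodes Th"
  obtains k where "\<And>i. k i \<le> M i" "z = grid_point k"
proof -
  obtain K where K: "K \<in> Th" "z \<in> vertices K" using assms unfolding nodes_def by blast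
  obtain k where k: "\<And>i. k i < M i" "K = cbox (\<chi> i. t i (k i)) (\<chi> i. t i (Suc (k i)))"
    "\<And>i. (\<chi> i. t i (k i)) $ i < (\<chi> i. t i (Suc (k i))) $ i" using cell[OF K(1)] by metis
  have "\<exists>l. l \<le> M i \<and> z $ i = t i l" for i
    using K(2) k(1)[of i] unfolding k(2) vertices_cbox[OF k(3)] by (auto intro: less_imp_le Suc_leI)
  then obtain l where "\<And>i. l i \<le> M i \<and> z $ i = t i (l i)" by metis
  then show ?thesis using that[of l] by (simp add: grid_point_def vec_eq_iff)
qed

lemma finite_nodes: "finite (nodes Th)"
proof -
  have "nodes Th \<subseteq> grid_point ` {k. \<forall>i. k i \<le> M i}"
  proof
    fix z assume "z \<in> nodes Th"
    then obtain k where "\<And>i. k i \<le> M i" "z = grid_point k" using nodes_grid_point by metis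
    then show "z \<in> grid_point ` {k. \<forall>i. k i \<le> M i}" by blast
  qed
  then show ?thesis by (rule finite_surj[OF finite_multi_index])
qed

lemma vertices_subset_nodes: "K \<in> Th \<Longrightarrow> vertices K \<subseteq> nodes Th"
  by (auto simp: nodes_def)

lemma nodes_subset_closure: "nodes Th \<subseteq> closure \<Omega>"
  by (auto simp: nodes_def vertices_def extreme_point_of_def closure_\<Omega>_eq_Union)

text \<open>The cells cover the closure of \<Omega>, on each of them vertex values decide, and
  outside both functions are zero by convention.\<close>

lemma Sh_eqI:
  assumes v: "v \<in> Sh \<Omega> Th" and w: "w \<in> Sh \<Omega> Th" and eq: "\<And>z. z \<in> nodes Th \<Longrightarrow> v z = w z"
  shows "v = w"
proof
  fix x
  show "v x = w x"
  proof (cases "x \<in> closure \<Omega>")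
    case False
    then show ?thesis using v w by (simp add: Sh_def)
  next
    case True
    then obtain K where K: "K \<in> Th" "x \<in> K" using closure_\<Omega>_eq_Union by blast
    obtain k where k: "\<And>i. k i < M i" "K = cbox (\<chi> i. t i (k i)) (\<chi> i. t i (Suc (k i)))"
      "\<And>i. (\<chi> i. t i (k i)) $ i < (\<chi> i. t i (Suc (k i))) $ i" using cell[OF K(1)] by metis
    have "v x $ j = w x $ j" for j
    proof (rule Q1_eq_on_cbox[OF k(3), where f = "\<lambda>x. v x $ j" and g = "\<lambda>x. w x $ j" and x = x, folded k(2)])
      show "(\<lambda>x. v x $ j) \<in> Q1 K" "(\<lambda>x. w x $ j) \<in> Q1 K" "x \<in> K"
        using v w K by (auto simp: Sh_def)
      show "v z $ j = w z $ j" if "z \<in> vertices K" for z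
        using eq[of z] that vertices_subset_nodes[OF K(1)] by auto
    qed
    then show ?thesis by (simp add: vec_eq_iff)
  qed
qed

definition tensor_hat :: "('d \<Rightarrow> nat) \<Rightarrow> real^'d \<Rightarrow> real" where
  "tensor_hat k x = (\<Prod>i\<in>UNIV. hat (t i) (M i) (k i) (x $ i))"

lemma tensor_hat_grid_point:
  assumes "\<And>i. k i \<le> M i" "\<And>i. l i \<le> M i"
  shows "tensor_hat k (grid_point l) = of_bool (k = l)"
proof -
  have "tensor_hat k (grid_point l) = (\<Prod>i\<in>UNIV. of_bool (k i = l i))"
    unfolding tensor_hat_def grid_point_def using hat_node[OF part] assms by (intro prod.cong) auto
  then show ?thesis by (auto simp: fun_eq_iff prod_zero_iff)
qed

lemma tensor_hat_add_axis:
  "tensor_hat k (x + s *\<^sub>R axis i 1)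
    = hat (t i) (M i) (k i) (x $ i + s) * (\<Prod>j\<in>UNIV - {i}. hat (t j) (M j) (k j) (x $ j))"
proof -
  have "tensor_hat k (x + s *\<^sub>R axis i 1) = hat (t i) (M i) (k i) ((x + s *\<^sub>R axis i 1) $ i)
    * (\<Prod>j\<in>UNIV - {i}. hat (t j) (M j) (k j) ((x + s *\<^sub>R axis i 1) $ j))"
    unfolding tensor_hat_def by (rule prod.remove) auto
  also have "(\<Prod>j\<in>UNIV - {i}. hat (t j) (M j) (k j) ((x + s *\<^sub>R axis i 1) $ j)) = (\<Prod>j\<in>UNIV - {i}. hat (t j) (M j) (k j) (x $ j))"
    by (intro prod.cong) (auto simp: axis_def)
  finally show ?thesis by (simp add: axis_def)
qed

text \<open>The sum runs over multi-indices to keep the tensor structure, and the function is left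
  uncut on the whole space, where \<open>H1_Lipschitz\<close> needs it.\<close>

definition hat_interp :: "(real^'d \<Rightarrow> real) \<Rightarrow> real^'d \<Rightarrow> real" where
  "hat_interp f x = (\<Sum>k | \<forall>i. k i \<le> M i. f (grid_point k) * tensor_hat k x)"

lemma hat_interp_node:
  assumes "z \<in> nodes Th"
  shows "hat_interp f z = f z"
proof -
  obtain l where l: "\<And>i. l i \<le> M i" "z = grid_point l" using nodes_grid_point[OF assms] by metis
  have "hat_interp f z = (\<Sum>k | \<forall>i. k i \<le> M i. if k = l then f (grid_point k) else 0)"
    unfolding hat_interp_def l(2) using l(1) by (intro sum.cong) (auto simp: tensor_hat_grid_point)
  also have "\<dots> = f z" using finite_multi_index l by simp
  finally show ?thesis .
qed

lemma hat_interp_Q1: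
  assumes "K \<in> Th"
  shows "hat_interp f \<in> Q1 K"
  unfolding hat_interp_def[abs_def]
proof (intro Q1_sum Q1_cmult)
  fix k assume "k \<in> {k. \<forall>i. k i \<le> M i}"
  then have k: "k i \<le> M i" for i by blast
  obtain j where j: "\<And>i. j i < M i" "K = cbox (\<chi> i. t i (j i)) (\<chi> i. t i (Suc (j i)))" using cell[OF assms] by metis
  have "\<exists>A B. \<forall>s. t i (j i) \<le> s \<and> s \<le> t i (Suc (j i)) \<longrightarrow> hat (t i) (M i) (k i) s = A + B * s" for i
    by (rule hat_affine[OF part k j(1)])
  then obtain A B where "\<And>i s. t i (j i) \<le> s \<Longrightarrow> s \<le> t i (Suc (j i)) \<Longrightarrow> hat (t i) (M i) (k i) s = A i + B i * s" by metis
  then show "tensor_hat k \<in> Q1 K"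
    unfolding tensor_hat_def[abs_def] j(2) by (intro Q1_prod_affine) (auto simp: mem_box_cart)
qed

text \<open>A shift in direction \<open>i\<close> changes only the \<open>i\<close>-th factor of
  each tensor product, while the others are bounded by 1; so Lipschitz bounds and derivatives reduce
  to those of one hat.\<close>

lemma hat_interp_H1:
  assumes v: "\<And>x. x \<in> \<Omega> \<Longrightarrow> v x = hat_interp f x"
  shows "v \<in> H1 \<Omega>"
proof -
  let ?I = "{k. \<forall>i. k i \<le> M i}"
  let ?P = "\<lambda>k i x. \<Prod>j\<in>UNIV - {i}. hat (t j) (M j) (k j) (x $ j)"
  define g where "g = (\<lambda>i x. \<Sum>k\<in>?I. f (grid_point k) * (hat_deriv (t i) (M i) (k i) (x $ i) * ?P k i x))"
  define L where "L i l = (SOME C. (\<forall>s s'. \<bar>hat (t i) (M i) l s - hat (t i) (M i) l s'\<bar> \<le> C * \<bar>s - s'\<bar>)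
    \<and> (\<forall>s. \<bar>hat_deriv (t i) (M i) l s\<bar> \<le> C))" for i l
  have L: "\<And>i l s s'. l \<le> M i \<Longrightarrow> \<bar>hat (t i) (M i) l s - hat (t i) (M i) l s'\<bar> \<le> L i l * \<bar>s - s'\<bar>"
    "\<And>i l s. l \<le> M i \<Longrightarrow> \<bar>hat_deriv (t i) (M i) l s\<bar> \<le> L i l"
    using someI_ex[OF hat_Lipschitz[OF part]] unfolding L_def by blast+
  have L0: "0 \<le> L i l" if "l \<le> M i" for i l
    using L(2)[OF that] abs_ge_zero order_trans by blast
  have P: "\<bar>?P k i x\<bar> \<le> 1" for k i x
    using hat_bounded by (simp add: abs_prod prod_le_1)
  \<comment> \<open>Summing the constants over all directions makes one \<open>C\<close> that is
    valid for every direction \<open>i\<close>.\<close>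
  define C where "C = (\<Sum>k\<in>?I. \<bar>f (grid_point k)\<bar> * (\<Sum>i\<in>UNIV. L i (k i)))"
  have L_sum: "L i (k i) \<le> (\<Sum>i\<in>UNIV. L i (k i))" if "\<forall>i. k i \<le> M i" for i k
    using that L0 by (intro member_le_sum) auto
  have lip: "\<bar>hat_interp f (x + s *\<^sub>R axis i 1) - hat_interp f x\<bar> \<le> C * \<bar>s\<bar>" for x i s
  proof -
    have eq: "hat_interp f (x + s *\<^sub>R axis i 1) - hat_interp f x
        = (\<Sum>k\<in>?I. f (grid_point k) * ((hat (t i) (M i) (k i) (x $ i + s) - hat (t i) (M i) (k i) (x $ i)) * ?P k i x))"
      using tensor_hat_add_axis[of _ x 0 i]
      by (simp add: hat_interp_def tensor_hat_add_axis algebra_simps flip: sum_subtractf)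
    have "\<bar>hat_interp f (x + s *\<^sub>R axis i 1) - hat_interp f x\<bar> \<le> (\<Sum>k\<in>?I. \<bar>f (grid_point k) * ((hat (t i) (M i) (k i) (x $ i + s) - hat (t i) (M i) (k i) (x $ i)) * ?P k i x)\<bar>)"
      unfolding eq by (rule sum_abs)
    also have "\<dots> \<le> (\<Sum>k\<in>?I. \<bar>f (grid_point k)\<bar> * (((\<Sum>i\<in>UNIV. L i (k i)) * \<bar>s\<bar>) * 1))"
      unfolding abs_mult
    proof (rule sum_mono)
      fix k assume "k \<in> ?I"
      then have k: "\<forall>i. k i \<le> M i" by blast
      have "\<bar>hat (t i) (M i) (k i) (x $ i + s) - hat (t i) (M i) (k i) (x $ i)\<bar> \<le> L i (k i) * \<bar>s\<bar>"
        using L(1)[OF spec[OF k, of i], of "x $ i + s" "x $ i"] by (simp only: add_diff_cancel_left')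
      also have "\<dots> \<le> (\<Sum>i\<in>UNIV. L i (k i)) * \<bar>s\<bar>"
        by (rule mult_right_mono[OF L_sum[OF k]]) simp
      finally have *: "\<bar>hat (t i) (M i) (k i) (x $ i + s) - hat (t i) (M i) (k i) (x $ i)\<bar> \<le> (\<Sum>i\<in>UNIV. L i (k i)) * \<bar>s\<bar>" .
      have "0 \<le> (\<Sum>i\<in>UNIV. L i (k i)) * \<bar>s\<bar>"
        by (intro mult_nonneg_nonneg sum_nonneg L0 spec[OF k] abs_ge_zero)
      from mult_left_mono[OF mult_mono[OF * P this abs_ge_zero] abs_ge_zero]
      show "\<bar>f (grid_point k)\<bar> * (\<bar>hat (t i) (M i) (k i) (x $ i + s) - hat (t i) (M i) (k i) (x $ i)\<bar> * \<bar>?P k i x\<bar>)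
        \<le> \<bar>f (grid_point k)\<bar> * (((\<Sum>i\<in>UNIV. L i (k i)) * \<bar>s\<bar>) * 1)" .
    qed
    also have "\<dots> = C * \<bar>s\<bar>" by (simp add: C_def sum_distrib_right mult.assoc)
    finally show ?thesis .
  qed
  have gC: "\<bar>g i x\<bar> \<le> C" for i x
  proof -
    have "\<bar>g i x\<bar> \<le> (\<Sum>k\<in>?I. \<bar>f (grid_point k) * (hat_deriv (t i) (M i) (k i) (x $ i) * ?P k i x)\<bar>)"
      unfolding g_def by (rule sum_abs)
    also have "\<dots> \<le> (\<Sum>k\<in>?I. \<bar>f (grid_point k)\<bar> * ((\<Sum>i\<in>UNIV. L i (k i)) * 1))"
      unfolding abs_mult
    proof (rule sum_mono)
      fix k assume "k \<in> ?I"
      then have k: "\<forall>i. k i \<le> M i" by blast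
      have *: "\<bar>hat_deriv (t i) (M i) (k i) (x $ i)\<bar> \<le> (\<Sum>i\<in>UNIV. L i (k i))"
        by (rule order_trans[OF L(2)[OF spec[OF k]] L_sum[OF k]])
      have "0 \<le> (\<Sum>i\<in>UNIV. L i (k i))"
        by (intro sum_nonneg L0 spec[OF k])
      from mult_left_mono[OF mult_mono[OF * P this abs_ge_zero] abs_ge_zero]
      show "\<bar>f (grid_point k)\<bar> * (\<bar>hat_deriv (t i) (M i) (k i) (x $ i)\<bar> * \<bar>?P k i x\<bar>)
        \<le> \<bar>f (grid_point k)\<bar> * ((\<Sum>i\<in>UNIV. L i (k i)) * 1)" .
    qed
    finally show ?thesis by (simp add: C_def)
  qed
  have cont: "continuous_on UNIV (\<lambda>x :: real^'d. hat (t j) (M j) l (x $ j))" for j l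
    by (rule continuous_on_compose2[OF continuous_on_hat continuous_on_component[OF continuous_on_id]]) simp
  have [measurable]: "(\<lambda>x :: real^'d. hat (t j) (M j) l (x $ j)) \<in> borel_measurable borel" for j l
    using cont by (rule borel_measurable_continuous_onI)
  have D: "AE x in lborel. ((\<lambda>s. hat_interp f (x + s *\<^sub>R axis i 1)) has_real_derivative g i x) (at 0)" for i
  proof -
    have "AE x in (lborel :: (real^'d) measure). \<forall>l\<in>{..M i}. x $ i \<noteq> t i l"
      by (intro AE_finite_allI AE_lborel_coordinate_neq) simp
    then show ?thesis
    proof eventually_elim
      case (elim x)
      have "((\<lambda>s. hat (t i) (M i) (k i) (x $ i + s)) has_real_derivative hat_deriv (t i) (M i) (k i) (x $ i)) (at 0)"
        if "k \<in> ?I" for k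
      proof -
        have "(hat (t i) (M i) (k i) has_real_derivative hat_deriv (t i) (M i) (k i) (x $ i)) (at (0 + x $ i))"
          unfolding add_0 by (rule hat_has_derivative[OF part]) (use that elim in auto)
        then show ?thesis unfolding DERIV_shift by (simp only: add.commute)
      qed
      then show ?case
        unfolding hat_interp_def g_def tensor_hat_add_axis
        by (intro DERIV_sum DERIV_cmult DERIV_cmult_right)
    qed
  qed
  have gm: "g i \<in> borel_measurable borel" for i
    unfolding g_def by measurable
  have c: "continuous_on UNIV (hat_interp f)"
    unfolding hat_interp_def[abs_def] tensor_hat_def[abs_def] by (intro continuous_intros cont)
  show ?thesis
    by (rule H1_Lipschitz[OF _ _ c lip gm gC D v]) (auto simp: \<Omega> bounded_box open_box)
qed

text \<open>This makes \<open>interp\<close> meaningful. Existence: tensor hats in each component,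
  cut off outside the closure of \<Omega>.\<close>

lemma interp_unique_existence: "\<exists>!v. v \<in> Sh \<Omega> Th \<and> (\<forall>z\<in>nodes Th. v z = f z)"
proof (rule ex_ex1I)
  define v where "v = (\<lambda>x. if x \<in> closure \<Omega> then (\<chi> j. hat_interp (\<lambda>z. f z $ j) x) else 0)"
  have "(\<lambda>x. v x $ j) \<in> H1 \<Omega>" for j
    by (rule hat_interp_H1[of _ "\<lambda>z. f z $ j"]) (use closure_subset in \<open>auto simp: v_def\<close>)
  moreover have "(\<lambda>x. v x $ j) \<in> Q1 K" if "K \<in> Th" for j K
    by (rule Q1_cong[OF hat_interp_Q1[OF that, of "\<lambda>z. f z $ j"]])
      (use that in \<open>auto simp: v_def closure_\<Omega>_eq_Union\<close>)
  ultimately have "v \<in> Sh \<Omega> Th" by (auto simp: Sh_def v_def)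
  moreover have "v z = f z" if "z \<in> nodes Th" for z
    using that nodes_subset_closure by (auto simp: v_def hat_interp_node vec_eq_iff)
  ultimately show "\<exists>v. v \<in> Sh \<Omega> Th \<and> (\<forall>z\<in>nodes Th. v z = f z)" by blast
qed (auto intro: Sh_eqI)

lemma interp_in_Sh: "interp \<Omega> Th f \<in> Sh \<Omega> Th"
  and interp_node: "z \<in> nodes Th \<Longrightarrow> interp \<Omega> Th f z = f z"
  using theI'[OF interp_unique_existence[of f]] unfolding interp_def by blast+

end

section \<open>One step of the lumped scheme\<close>

unbundle cross3_syntax

text \<open>The map \<open>x\<close> to \<open>m \<times> x\<close> is skew, so its square is
  negative semidefinite. All dissipation in the scheme has its sign from here.\<close>

lemma inner_cross3_cross3_self:
  fixes m x :: "real^3"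
  shows "x \<bullet> (m \<times> (m \<times> x)) = - (norm (m \<times> x))\<^sup>2"
proof -
  have "x \<bullet> (m \<times> (m \<times> x)) = - ((m \<times> x) \<bullet> (m \<times> x))"
    by (metis cross_triple cross_skew inner_commute inner_minus_left inner_minus_right)
  then show ?thesis by (simp add: power2_norm_eq_inner)
qed

text \<open>With \<open>r\<close>, \<open>s\<close> the two norms and \<open>k\<close> the cosine of
  the angle, the squared norms of the two sides differ by
  \<open>(r - s)\<^sup>2 + 2 * ((r * s - 1) * (1 - k))\<close>, which is nonnegative for
  \<open>r\<close>, \<open>s\<close> at least 1.\<close>

lemma norm_normalize_diff_le:
  fixes x y :: "'a::real_inner"
  assumes "1 \<le> norm x" "1 \<le> norm y"
  shows "norm (x /\<^sub>R norm x - y /\<^sub>R norm y) \<le> norm (x - y)"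
proof -
  define r s k where "r = norm x" and "s = norm y" and "k = (x /\<^sub>R r) \<bullet> (y /\<^sub>R s)"
  have rs: "1 \<le> r" "1 \<le> s" using assms by (auto simp: r_def s_def)
  have "1 * 1 \<le> r * s" using rs by (intro mult_mono) auto
  have n0: "norm x \<noteq> 0" "norm y \<noteq> 0" using assms by auto
  have "k \<le> norm (x /\<^sub>R r) * norm (y /\<^sub>R s)" unfolding k_def by (rule norm_cauchy_schwarz)
  also have "\<dots> = 1" using n0 by (simp add: r_def s_def)
  finally have "k \<le> 1" .
  have "r \<noteq> 0" "s \<noteq> 0" using rs by auto
  then have xy: "x \<bullet> y = r * s * k" by (simp add: k_def divide_simps)
  define X Y where "X = x /\<^sub>R r" and "Y = y /\<^sub>R s"
  have "norm X = 1" "norm Y = 1" using n0 by (simp_all add: X_def Y_def r_def s_def)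
  then have "(norm (X - Y))\<^sup>2 = 2 - 2 * (X \<bullet> Y)"
    by (simp add: power2_norm_eq_inner inner_diff_left inner_diff_right inner_commute norm_eq_1)
  then have "(norm (x /\<^sub>R r - y /\<^sub>R s))\<^sup>2 = 2 - 2 * k"
    unfolding X_def Y_def k_def .
  also have "\<dots> \<le> r\<^sup>2 + s\<^sup>2 - 2 * (r * s * k)"
  proof -
    have "0 \<le> (r - s)\<^sup>2 + 2 * ((r * s - 1) * (1 - k))"
      using \<open>1 * 1 \<le> r * s\<close> \<open>k \<le> 1\<close> by simp
    then show ?thesis by (simp add: power2_eq_square algebra_simps)
  qed
  also have "\<dots> = (norm (x - y))\<^sup>2"
    unfolding xy[symmetric] unfolding r_def s_def
    by (simp add: power2_norm_eq_inner inner_diff_left inner_diff_right inner_commute)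
  finally show ?thesis
    unfolding r_def s_def using power2_le_imp_le norm_ge_zero by blast
qed

text \<open>What remains of the mesh: nodes \<open>Z\<close> with lumped masses \<beta>, and a
  weighted graph with edge ends \<open>p\<close> and \<open>q\<close>. Edges form an index set, so
  the same pair of nodes may be joined several times.\<close>

locale lumped_form =
  fixes Z :: "'a set" and \<beta> :: "'a \<Rightarrow> real"
    and E :: "'e set" and c :: "'e \<Rightarrow> real" and p q :: "'e \<Rightarrow> 'a"
  assumes finite_Z: "finite Z" and finite_E: "finite E"
    and \<beta>_pos: "z \<in> Z \<Longrightarrow> 0 < \<beta> z" and c_nonneg: "e \<in> E \<Longrightarrow> 0 \<le> c e"
    and p_in: "e \<in> E \<Longrightarrow> p e \<in> Z" and q_in: "e \<in> E \<Longrightarrow> q e \<in> Z"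
begin

definition mass :: "('a \<Rightarrow> real^3) \<Rightarrow> ('a \<Rightarrow> real^3) \<Rightarrow> real" where
  "mass v w = (\<Sum>z\<in>Z. \<beta> z * (v z \<bullet> w z))"

definition stiff :: "('a \<Rightarrow> real^3) \<Rightarrow> ('a \<Rightarrow> real^3) \<Rightarrow> real" where
  "stiff v w = (\<Sum>e\<in>E. c e * ((v (p e) - v (q e)) \<bullet> (w (p e) - w (q e))))"

text \<open>The weighted graph Laplacian relative to the lumped masses, with the sign for which
  \<open>mass_lap\<close> holds.\<close>

definition lap :: "('a \<Rightarrow> real^3) \<Rightarrow> 'a \<Rightarrow> real^3" where
  "lap v z = - ((\<Sum>e\<in>E. (c e * (of_bool (z = p e) - of_bool (z = q e))) *\<^sub>R (v (p e) - v (q e))) /\<^sub>R \<beta> z)"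

lemma lap_add: "lap (\<lambda>x. u x + v x) z = lap u z + lap v z"
  by (simp add: lap_def sum.distrib algebra_simps scaleR_sum_right sum_subtractf sum_negf)

lemma lap_scale: "lap (\<lambda>x. r *\<^sub>R u x) z = r *\<^sub>R lap u z"
  by (simp add: lap_def scaleR_sum_right flip: scaleR_diff_right) (simp add: mult.commute mult.left_commute)

lemma lap_cong: "(\<And>z. z \<in> Z \<Longrightarrow> u z = v z) \<Longrightarrow> lap u = lap v"
  unfolding lap_def fun_eq_iff by (simp add: p_in q_in cong: sum.cong)

text \<open>Summation by parts: after exchanging the sums, an edge meets only its two ends, with
  opposite signs, and the masses cancel.\<close>

lemma mass_lap: "mass (lap v) w = - stiff v w"
proof -
  have "mass (lap v) w = (\<Sum>z\<in>Z. \<Sum>e\<in>E. - (c e * (of_bool (z = p e) - of_bool (z = q e)) * ((v (p e) - v (q e)) \<bullet> w z)))"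
    unfolding mass_def
  proof (rule sum.cong[OF refl])
    fix z assume "z \<in> Z"
    then show "\<beta> z * (lap v z \<bullet> w z) = (\<Sum>e\<in>E. - (c e * (of_bool (z = p e) - of_bool (z = q e)) * ((v (p e) - v (q e)) \<bullet> w z)))"
      using \<beta>_pos[of z] by (simp add: lap_def inner_sum_left sum_negf)
  qed
  also have "\<dots> = (\<Sum>e\<in>E. \<Sum>z\<in>Z. - (c e * (of_bool (z = p e) - of_bool (z = q e)) * ((v (p e) - v (q e)) \<bullet> w z)))"
    by (rule sum.swap)
  also have "\<dots> = (\<Sum>e\<in>E. - (c e * ((v (p e) - v (q e)) \<bullet> (w (p e) - w (q e)))))"
  proof (rule sum.cong[OF refl])
    fix e assume e: "e \<in> E"
    define d where "d = v (p e) - v (q e)"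
    have "(\<Sum>z\<in>Z. - (c e * (of_bool (z = p e) - of_bool (z = q e)) * (d \<bullet> w z)))
      = (\<Sum>z\<in>Z. (if z = q e then c e * (d \<bullet> w z) else 0) - (if z = p e then c e * (d \<bullet> w z) else 0))"
      by (intro sum.cong) auto
    also have "\<dots> = c e * (d \<bullet> w (q e)) - c e * (d \<bullet> w (p e))"
      using p_in[OF e] q_in[OF e] finite_Z by (simp add: sum_subtractf)
    finally show "(\<Sum>z\<in>Z. - (c e * (of_bool (z = p e) - of_bool (z = q e)) * ((v (p e) - v (q e)) \<bullet> w z)))
      = - (c e * ((v (p e) - v (q e)) \<bullet> (w (p e) - w (q e))))"
      unfolding d_def[symmetric] by (simp add: inner_diff_right algebra_simps)
  qed
  finally show ?thesis by (simp add: stiff_def sum_negf)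
qed

lemma stiff_nonneg: "0 \<le> stiff v v"
  unfolding stiff_def by (intro sum_nonneg mult_nonneg_nonneg c_nonneg) auto

lemma mass_nonneg: "0 \<le> mass v v"
  unfolding mass_def by (intro sum_nonneg mult_nonneg_nonneg less_imp_le[OF \<beta>_pos]) auto

lemma mass_self_eq_0: "mass v v = 0 \<Longrightarrow> z \<in> Z \<Longrightarrow> v z = 0"
proof -
  assume 0: "mass v v = 0" and z: "z \<in> Z"
  have "\<forall>z\<in>Z. \<beta> z * (v z \<bullet> v z) = 0"
    using 0 unfolding mass_def
    by (subst (asm) sum_nonneg_eq_0_iff) (auto intro!: finite_Z mult_nonneg_nonneg less_imp_le[OF \<beta>_pos])
  then show "v z = 0" using \<beta>_pos[OF z] z by force
qed

lemma stiff_mono: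
  assumes "\<And>x y. x \<in> Z \<Longrightarrow> y \<in> Z \<Longrightarrow> norm (v x - v y) \<le> norm (w x - w y)"
  shows "stiff v v \<le> stiff w w"
  unfolding stiff_def
  by (intro sum_mono mult_left_mono c_nonneg)
    (use assms p_in q_in in \<open>auto simp: norm_le\<close>)

text \<open>Edge by edge, twice \<open>x \<bullet> (x - y)\<close> is the square of \<open>x\<close>
  minus that of \<open>y\<close> plus that of \<open>x - y\<close>. The last square is the gain of
  the implicit step.\<close>

lemma stiff_parallelogram:
  "stiff u u - stiff m m + stiff (\<lambda>z. u z - m z) (\<lambda>z. u z - m z) = 2 * stiff u (\<lambda>z. u z - m z)"
  unfolding stiff_def sum_subtractf[symmetric] sum.distrib[symmetric] sum_distrib_left
  by (intro sum.cong) (auto simp: inner_diff_left inner_diff_right inner_commute algebra_simps)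

section \<open>A single step at the nodes: solvability and energy\<close>

definition is_step :: "real \<Rightarrow> ('a \<Rightarrow> real^3) \<Rightarrow> ('a \<Rightarrow> real^3) \<Rightarrow> bool" where
  "is_step \<tau> m u \<longleftrightarrow> (\<forall>z\<in>Z. u z - m z = - (\<tau> *\<^sub>R (m z \<times> (m z \<times> lap u z))))"

lemma is_step_cong: "is_step \<tau> m u \<Longrightarrow> (\<And>z. z \<in> Z \<Longrightarrow> u z = v z) \<Longrightarrow> is_step \<tau> m v"
  using lap_cong[of u v] by (simp add: is_step_def)

text \<open>Stated for a general increment \<open>w\<close>, so that it covers both the homogeneous
  system, where \<open>w\<close> is \<open>u\<close>, and the energy estimate, where
  \<open>w\<close> is \<open>u - m\<close>.\<close>

lemma stiff_increment:
  assumes "\<And>z. z \<in> Z \<Longrightarrow> w z = - (\<tau> *\<^sub>R (m z \<times> (m z \<times> lap u z)))"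
  shows "stiff u w = - \<tau> * mass (\<lambda>z. m z \<times> lap u z) (\<lambda>z. m z \<times> lap u z)"
proof -
  have "stiff u w = - mass (lap u) w" by (simp add: mass_lap)
  also have "mass (lap u) w = \<tau> * mass (\<lambda>z. m z \<times> lap u z) (\<lambda>z. m z \<times> lap u z)"
    unfolding mass_def sum_distrib_left using assms
    by (intro sum.cong) (auto simp: inner_cross3_cross3_self power2_norm_eq_inner)
  finally show ?thesis by simp
qed

text \<open>A nonnegative energy equals minus \<tau> times a nonnegative dissipation. So the
  dissipation is zero, \<open>m \<times> lap w\<close> vanishes at the nodes, and the equation
  itself gives \<open>w = 0\<close>.\<close>

lemma step_homogeneous:
  assumes "0 < \<tau>" and w: "\<And>z. z \<in> Z \<Longrightarrow> w z = - (\<tau> *\<^sub>R (m z \<times> (m z \<times> lap w z)))" and z: "z \<in> Z"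
  shows "w z = 0"
proof -
  let ?y = "\<lambda>z. m z \<times> lap w z"
  have "stiff w w = - \<tau> * mass ?y ?y" using stiff_increment[of w \<tau> m w] w by blast
  then have "\<tau> * mass ?y ?y \<le> 0" using stiff_nonneg[of w] by simp
  then have "mass ?y ?y = 0" using assms(1) mass_nonneg[of ?y] by (simp add: mult_le_0_iff)
  then have "m z \<times> lap w z = 0" using mass_self_eq_0[of ?y] z by blast
  then show ?thesis using w[OF z] by simp
qed

lemma is_step_unique:
  assumes "0 < \<tau>" "is_step \<tau> m u" "is_step \<tau> m v" "z \<in> Z"
  shows "u z = v z"
proof -
  have lap: "lap (\<lambda>x. u x - v x) z = lap u z - lap v z" for z
    using lap_add[of u "\<lambda>x. (-1) *\<^sub>R v x" z] lap_scale[of "-1" v z] by simp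
  have "u z - v z = 0"
  proof (rule step_homogeneous[OF assms(1), where m = m])
    fix z assume z: "z \<in> Z"
    have "u z - v z = (u z - m z) - (v z - m z)" by simp
    also have "\<dots> = - (\<tau> *\<^sub>R (m z \<times> (m z \<times> (lap u z - lap v z))))"
      using assms(2,3) z by (simp add: is_step_def Cross3.right_diff_distrib scaleR_diff_right)
    finally show "u z - v z = - (\<tau> *\<^sub>R (m z \<times> (m z \<times> lap (\<lambda>x. u x - v x) z)))"
      by (simp add: lap)
  qed fact
  then show ?thesis by simp
qed

text \<open>With the implicit term moved to the left the step is a square linear system
  \<open>?L u = m\<close> on the nodes, so injectivity is enough.\<close>

lemma is_step_exists:
  assumes "0 < \<tau>"
  obtains u where "is_step \<tau> m u"
proof -
  let ?L = "\<lambda>u z. u z + \<tau> *\<^sub>R (m z \<times> (m z \<times> lap u z))"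
  obtain u where "\<And>z. z \<in> Z \<Longrightarrow> ?L u z = m z"
  proof (rule finite_support_injective_imp_surjective[OF finite_Z, where L = ?L and f = m])
    fix u assume u: "\<And>z. z \<notin> Z \<Longrightarrow> u z = 0" "\<And>z. z \<in> Z \<Longrightarrow> ?L u z = 0"
    then have "u z = 0" if "z \<in> Z" for z
      using step_homogeneous[OF assms _ that, of u m] by (simp add: eq_neg_iff_add_eq_0)
    then show "u = (\<lambda>z. 0)" using u(1) by blast
  qed (auto simp: lap_add lap_scale cross_add_right cross_mult_right algebra_simps)
  then have "is_step \<tau> m u" by (simp add: is_step_def algebra_simps)
  then show ?thesis using that by blast
qed

lemma is_step_norm_ge_1:
  assumes "is_step \<tau> m u" "z \<in> Z" "norm (m z) = 1"
  shows "1 \<le> norm (u z)"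
proof -
  have "u z = m z - \<tau> *\<^sub>R (m z \<times> (m z \<times> lap u z))"
    using assms(1,2) by (simp add: is_step_def algebra_simps)
  then have "u z \<bullet> m z = 1"
    using assms(3) by (simp add: inner_diff_left dot_cross_self norm_eq_1)
  then show ?thesis
    using norm_cauchy_schwarz[of "u z" "m z"] assms(3) by simp
qed

text \<open>The energy of the increment in \<open>stiff_parallelogram\<close> is nonnegative and
  dropped; the factor 2 there produces the halves here.\<close>

lemma is_step_energy:
  assumes u: "is_step \<tau> m u" and m: "\<And>z. z \<in> Z \<Longrightarrow> norm (m z) = 1"
    and n: "\<And>z. z \<in> Z \<Longrightarrow> n z = u z /\<^sub>R norm (u z)"
  shows "1 / 2 * stiff n n + \<tau> * mass (\<lambda>z. m z \<times> lap u z) (\<lambda>z. m z \<times> lap u z) \<le> 1 / 2 * stiff m m"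
proof -
  have "stiff n n \<le> stiff u u"
    using n is_step_norm_ge_1[OF u _ m] by (intro stiff_mono) (simp add: norm_normalize_diff_le)
  moreover have "stiff u (\<lambda>z. u z - m z) = - \<tau> * mass (\<lambda>z. m z \<times> lap u z) (\<lambda>z. m z \<times> lap u z)"
    using u by (intro stiff_increment) (simp add: is_step_def)
  ultimately show ?thesis
    using stiff_parallelogram[of u m] stiff_nonneg[of "\<lambda>z. u z - m z"] by linarith
qed

end

unbundle no cross3_syntax

section \<open>The projection scheme\<close>

context cart_mesh
begin

text \<open>Recovers the corners from the set \<open>K\<close>, so that edges can be indexed by
  cells instead of multi-indices.\<close>

lemma cell_bounds:
  assumes "K \<in> Th"
  shows "K = cbox (interval_lowerbound K) (interval_upperbound K)"
    and "interval_lowerbound K $ i < interval_upperbound K $ i"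
proof -
  obtain k where k: "K = cbox (\<chi> i. t i (k i)) (\<chi> i. t i (Suc (k i)))"
    "\<And>i. (\<chi> i. t i (k i)) $ i < (\<chi> i. t i (Suc (k i))) $ i" using cell[OF assms] by metis
  define p q where "p = (\<chi> i. t i (k i))" and "q = (\<chi> i. t i (Suc (k i)))"
  have K: "K = cbox p q" and pq: "p $ i < q $ i" for i using k by (simp_all add: p_def q_def)
  have "\<forall>e\<in>Basis. p \<bullet> e \<le> q \<bullet> e" using pq by (auto simp: Basis_vec_def inner_axis less_imp_le)
  then have "interval_lowerbound K = p" "interval_upperbound K = q" by (simp_all add: K)
  then show "K = cbox (interval_lowerbound K) (interval_upperbound K)"
    "interval_lowerbound K $ i < interval_upperbound K $ i"
    using K pq by simp_all
qed

lemma vertices_cell: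
  assumes "K \<in> Th"
  shows "vertices K = {z. \<forall>i. z $ i = interval_lowerbound K $ i \<or> z $ i = interval_upperbound K $ i}"
proof -
  have "vertices (cbox (interval_lowerbound K) (interval_upperbound K))
      = {z. \<forall>i. z $ i = interval_lowerbound K $ i \<or> z $ i = interval_upperbound K $ i}"
    by (rule vertices_cbox[OF cell_bounds(2)[OF assms]])
  then show ?thesis unfolding cell_bounds(1)[OF assms, symmetric] .
qed

lemma upd_in_vertices:
  assumes "K \<in> Th" "z \<in> vertices K"
  shows "upd z i (interval_lowerbound K $ i) \<in> vertices K" "upd z i (interval_upperbound K $ i) \<in> vertices K"
  using assms(2) unfolding vertices_cell[OF assms(1)] by (auto simp: upd_nth)

lemma finite_vertices: "K \<in> Th \<Longrightarrow> finite (vertices K)"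
  using finite_subset[OF vertices_subset_nodes finite_nodes] .

lemma quad_weight_pos:
  assumes "K \<in> Th"
  shows "0 < quad_weight K"
proof -
  have "0 < measure lborel (cbox (interval_lowerbound K) (interval_upperbound K))"
    by (rule content_pos_lt) (auto simp: Basis_vec_def inner_axis cell_bounds(2)[OF assms])
  then have "0 < measure lborel K" unfolding cell_bounds(1)[OF assms, symmetric] .
  moreover have "K \<in> sets lborel" by (subst cell_bounds(1)[OF assms]) simp
  ultimately show ?thesis by (simp add: quad_weight_def)
qed

text \<open>The lumped mass at \<open>z\<close>, as it arises from exchanging the sums over cells
  and vertices in \<open>inner_h\<close>.\<close>

definition node_weight :: "real^'d \<Rightarrow> real" where
  "node_weight z = (\<Sum>K | K \<in> Th \<and> z \<in> vertices K. quad_weight K)"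

text \<open>The triple \<open>(K, z, i)\<close> stands for the edge of \<open>K\<close> through its vertex \<open>z\<close> in direction \<open>i\<close>: the
  \<open>i\<close>-th partial derivative at \<open>z\<close> of a \<open>Q\<^sub>1\<close> function is its difference quotient along that edge.\<close>
definition edges :: "((real^'d) set \<times> (real^'d) \<times> 'd) set" where
  "edges = (SIGMA K:Th. vertices K \<times> UNIV)"

text \<open>The squared length stems from multiplying two difference quotients. An edge of
  \<open>K\<close> is indexed once for each of its two ends, matching the sum over vertices in
  \<open>grad_inner_h\<close>.\<close>

definition edge_weight :: "(real^'d) set \<times> (real^'d) \<times> 'd \<Rightarrow> real" where
  "edge_weight = (\<lambda>(K, z, i). quad_weight K / (interval_upperbound K $ i - interval_lowerbound K $ i)\<^sup>2)"

definition edge_end :: "(real^'d) set \<times> (real^'d) \<times> 'd \<Rightarrow> real^'d" where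
  "edge_end = (\<lambda>(K, z, i). upd z i (interval_upperbound K $ i))"

definition edge_start :: "(real^'d) set \<times> (real^'d) \<times> 'd \<Rightarrow> real^'d" where
  "edge_start = (\<lambda>(K, z, i). upd z i (interval_lowerbound K $ i))"

sublocale lumped_form "nodes Th" node_weight edges edge_weight edge_end edge_start
proof
  show "finite edges"
    unfolding edges_def by (intro finite_SigmaI finite_Th finite_cartesian_product finite_vertices finite)
  show "0 < node_weight z" if z: "z \<in> nodes Th" for z
    unfolding node_weight_def
  proof (rule sum_pos)
    show "{K. K \<in> Th \<and> z \<in> vertices K} \<noteq> {}" using z by (auto simp: nodes_def)
  qed (auto simp: finite_Th quad_weight_pos)
  show "0 \<le> edge_weight e" if "e \<in> edges" for e
    using that by (auto simp: edges_def edge_weight_def less_imp_le[OF quad_weight_pos])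
  show "edge_end e \<in> nodes Th" "edge_start e \<in> nodes Th" if "e \<in> edges" for e
    using that
    by (auto simp: edges_def edge_end_def edge_start_def intro: subsetD[OF vertices_subset_nodes] upd_in_vertices)
qed (rule finite_nodes)

lemma inner_h_eq_mass: "inner_h Th v w = mass v w"
proof -
  have "inner_h Th v w = (\<Sum>K\<in>Th. \<Sum>z | z \<in> nodes Th \<and> z \<in> vertices K. quad_weight K * (v z \<bullet> w z))"
    unfolding inner_h_def using vertices_subset_nodes by (intro sum.cong) auto
  also have "\<dots> = (\<Sum>z\<in>nodes Th. \<Sum>K | K \<in> Th \<and> z \<in> vertices K. quad_weight K * (v z \<bullet> w z))"
    by (rule sum.swap_restrict[OF finite_Th finite_nodes])
  finally show ?thesis by (simp add: mass_def node_weight_def sum_distrib_right)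
qed

lemma jacobian_cell:
  assumes v: "v \<in> Sh \<Omega> Th" and K: "K \<in> Th" and z: "z \<in> vertices K"
  shows "jacobian v (at z within K) $ j $ i
    = (v (edge_end (K, z, i)) - v (edge_start (K, z, i))) $ j
        / (interval_upperbound K $ i - interval_lowerbound K $ i)"
proof -
  have "(\<lambda>x. v x $ j) \<in> Q1 K" for j using v K by (simp add: Sh_def)
  then show ?thesis
    using jacobian_Q1[OF cell_bounds(2)[OF K], of v z j i] z
    unfolding cell_bounds(1)[OF K, symmetric] by (simp add: edge_end_def edge_start_def)
qed

text \<open>In the Frobenius product the sum over components \<open>j\<close> gives the inner
  product of two edge differences; the direction \<open>i\<close> remains as edge label.\<close>

lemma grad_inner_h_eq_stiff:
  assumes v: "v \<in> Sh \<Omega> Th" and w: "w \<in> Sh \<Omega> Th"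
  shows "grad_inner_h Th v w = stiff v w"
proof -
  define g where "g e = edge_weight e * ((v (edge_end e) - v (edge_start e)) \<bullet> (w (edge_end e) - w (edge_start e)))" for e
  have "quad_weight K * (jacobian v (at z within K) \<bullet> jacobian w (at z within K)) = (\<Sum>i\<in>UNIV. g (K, z, i))"
    if K: "K \<in> Th" and z: "z \<in> vertices K" for K z
  proof -
    have "jacobian v (at z within K) \<bullet> jacobian w (at z within K)
      = (\<Sum>i\<in>UNIV. \<Sum>j\<in>UNIV. jacobian v (at z within K) $ j $ i * jacobian w (at z within K) $ j $ i)"
      unfolding inner_vec_def inner_real_def by (rule sum.swap)
    also have "\<dots> = (\<Sum>i\<in>UNIV. ((v (edge_end (K, z, i)) - v (edge_start (K, z, i)))
        \<bullet> (w (edge_end (K, z, i)) - w (edge_start (K, z, i)))) / (interval_upperbound K $ i - interval_lowerbound K $ i)\<^sup>2)"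
      unfolding jacobian_cell[OF v K z] jacobian_cell[OF w K z]
      by (simp add: inner_vec_def sum_divide_distrib power2_eq_square)
    finally show ?thesis
      by (simp add: g_def edge_weight_def sum_distrib_left)
  qed
  then have "grad_inner_h Th v w = (\<Sum>K\<in>Th. \<Sum>z\<in>vertices K. \<Sum>i\<in>UNIV. g (K, z, i))"
    unfolding grad_inner_h_def by (intro sum.cong) auto
  also have "\<dots> = (\<Sum>K\<in>Th. \<Sum>y\<in>vertices K \<times> UNIV. g (K, y))"
    by (simp add: sum.cartesian_product split_def)
  also have "\<dots> = sum g edges"
    unfolding edges_def using finite_Th finite_vertices by (subst sum.Sigma) (auto simp: split_def)
  finally show ?thesis by (simp add: stiff_def g_def)
qed

text \<open>The interpolant of \<open>u - v\<close> is an admissible test function and gives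
  \<open>mass d d = 0\<close>. Here \<open>u\<close> and \<open>v\<close> are arbitrary functions,
  since cross products of elements of \<open>Sh\<close> need not be in \<open>Sh\<close>.\<close>

lemma inner_h_test_iff:
  "(\<forall>w\<in>Sh \<Omega> Th. inner_h Th u w = inner_h Th v w) \<longleftrightarrow> (\<forall>z\<in>nodes Th. u z = v z)"
proof
  assume *: "\<forall>w\<in>Sh \<Omega> Th. inner_h Th u w = inner_h Th v w"
  define d where "d = (\<lambda>x. u x - v x)"
  have "mass u (interp \<Omega> Th d) = mass v (interp \<Omega> Th d)"
    using * interp_in_Sh by (simp add: inner_h_eq_mass)
  moreover have "mass u (interp \<Omega> Th d) - mass v (interp \<Omega> Th d) = mass d d"
    unfolding mass_def sum_subtractf[symmetric]
    by (intro sum.cong) (simp_all add: interp_node d_def inner_diff_left right_diff_distrib)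
  ultimately have "mass d d = 0" by simp
  then have "d z = 0" if "z \<in> nodes Th" for z using mass_self_eq_0 that by blast
  then show "\<forall>z\<in>nodes Th. u z = v z" by (simp add: d_def)
next
  assume "\<forall>z\<in>nodes Th. u z = v z"
  then show "\<forall>w\<in>Sh \<Omega> Th. inner_h Th u w = inner_h Th v w" by (simp add: inner_h_eq_mass mass_def)
qed

text \<open>The interpolant of \<open>lap v\<close> has the defining property by
  \<open>mass_lap\<close>, and testing shows that it is the only one; so the definite description
  denotes it.\<close>

lemma discrete_laplacian_node:
  assumes v: "v \<in> Sh \<Omega> Th" and z: "z \<in> nodes Th"
  shows "discrete_laplacian \<Omega> Th v z = lap v z"
proof -
  define u where "u = interp \<Omega> Th (lap v)"
  have u_Sh: "u \<in> Sh \<Omega> Th" by (simp add: u_def interp_in_Sh)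
  have u_node: "u z = lap v z" if "z \<in> nodes Th" for z using that by (simp add: u_def interp_node)
  have u: "inner_h Th u w = - grad_inner_h Th v w" if "w \<in> Sh \<Omega> Th" for w
  proof -
    have "inner_h Th u w = mass (lap v) w" by (simp add: inner_h_eq_mass mass_def u_node)
    then show ?thesis using v that by (simp add: mass_lap grad_inner_h_eq_stiff)
  qed
  have "discrete_laplacian \<Omega> Th v = u"
    unfolding discrete_laplacian_def
  proof (rule the_equality)
    fix u' assume u': "u' \<in> Sh \<Omega> Th \<and> (\<forall>w\<in>Sh \<Omega> Th. inner_h Th u' w = - grad_inner_h Th v w)"
    then have "\<forall>w\<in>Sh \<Omega> Th. inner_h Th u' w = inner_h Th u w" using u by simp
    then have "\<forall>z\<in>nodes Th. u' z = u z" unfolding inner_h_test_iff .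
    then show "u' = u" using Sh_eqI u' u_Sh by blast
  qed (use u u_Sh in blast)
  then show ?thesis using u_node[OF z] by simp
qed

text \<open>Membership of \<open>u\<close> in \<open>Sh\<close> identifies its discrete Laplacian at
  the nodes; \<open>m\<close> enters through nodal values only.\<close>

lemma variational_step_iff:
  assumes "0 < \<tau>" and u: "u \<in> Sh \<Omega> Th"
  shows "(\<forall>v\<in>Sh \<Omega> Th. inner_h Th (\<lambda>x. (u x - m x) /\<^sub>R \<tau>) v
      = - inner_h Th (\<lambda>x. cross3 (m x) (cross3 (m x) (discrete_laplacian \<Omega> Th u x))) v)
    \<longleftrightarrow> is_step \<tau> m u"
proof -
  let ?r = "\<lambda>x. cross3 (m x) (cross3 (m x) (discrete_laplacian \<Omega> Th u x))"
  have "- inner_h Th ?r v = inner_h Th (\<lambda>x. - ?r x) v" for v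
    by (simp add: inner_h_eq_mass mass_def sum_negf)
  then have "(\<forall>v\<in>Sh \<Omega> Th. inner_h Th (\<lambda>x. (u x - m x) /\<^sub>R \<tau>) v = - inner_h Th ?r v)
    \<longleftrightarrow> (\<forall>z\<in>nodes Th. (u z - m z) /\<^sub>R \<tau> = - ?r z)"
    using inner_h_test_iff[of "\<lambda>x. (u x - m x) /\<^sub>R \<tau>" "\<lambda>x. - ?r x"] by simp
  also have "\<dots> \<longleftrightarrow> is_step \<tau> m u"
    unfolding is_step_def
  proof (rule ball_cong[OF refl])
    fix z assume z: "z \<in> nodes Th"
    have "(u z - m z) /\<^sub>R \<tau> = - y \<longleftrightarrow> u z - m z = - (\<tau> *\<^sub>R y)" for y
    proof
      assume "(u z - m z) /\<^sub>R \<tau> = - y"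
      then have "\<tau> *\<^sub>R ((u z - m z) /\<^sub>R \<tau>) = \<tau> *\<^sub>R (- y)" by (rule arg_cong)
      then show "u z - m z = - (\<tau> *\<^sub>R y)" using assms(1) by simp
    qed (use assms(1) in simp)
    then show "(u z - m z) /\<^sub>R \<tau> = - ?r z \<longleftrightarrow> u z - m z = - (\<tau> *\<^sub>R cross3 (m z) (cross3 (m z) (lap u z)))"
      by (simp add: discrete_laplacian_node[OF u z])
  qed
  finally show ?thesis .
qed

lemma scheme_solution_iff:
  assumes "0 < T" "1 \<le> N"
  shows "scheme_solution \<Omega> Th m0 T N (mt, m) \<longleftrightarrow>
     mt \<in> {0..N} \<rightarrow>\<^sub>E Sh \<Omega> Th \<and> m \<in> {0..N} \<rightarrow>\<^sub>E Sh \<Omega> Th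
     \<and> m 0 = interp \<Omega> Th m0 \<and> mt 0 = interp \<Omega> Th m0
     \<and> (\<forall>n<N. is_step (T / real N) (m n) (mt (Suc n)) \<and> (\<forall>z\<in>nodes Th. mt (Suc n) z \<noteq> 0)
          \<and> m (Suc n) = interp \<Omega> Th (\<lambda>x. mt (Suc n) x /\<^sub>R norm (mt (Suc n) x)))"
proof -
  have *: "(\<forall>v\<in>Sh \<Omega> Th. inner_h Th (\<lambda>x. (mt (Suc n) x - m n x) /\<^sub>R (T / real N)) v
      = - inner_h Th (\<lambda>x. cross3 (m n x) (cross3 (m n x) (discrete_laplacian \<Omega> Th (mt (Suc n)) x))) v)
    \<longleftrightarrow> is_step (T / real N) (m n) (mt (Suc n))"
    if "mt \<in> {0..N} \<rightarrow>\<^sub>E Sh \<Omega> Th" "n < N" for n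
    by (rule variational_step_iff) (use that assms in auto)
  show ?thesis
    \<comment> \<open>These congruence rules carry the membership of \<open>mt\<close> and
      \<open>n < N\<close> into the last conjunct, where \<open>*\<close> relies on them.\<close>
    unfolding scheme_solution_def prod.case
    by (rule conj_cong[OF refl], rule conj_cong[OF refl], rule conj_cong[OF refl], rule conj_cong[OF refl],
        rule all_cong, rule conj_cong[OF _ refl], rule *)
qed

section \<open>Existence, uniqueness and energy bound of the iterates\<close>

context
  fixes T :: real and N :: nat and m0 :: "real^'d \<Rightarrow> real^3"
  assumes T: "0 < T" and N: "1 \<le> N" and m0: "\<forall>x\<in>closure \<Omega>. norm (m0 x) = 1"
begin

lemma step_size_pos: "0 < T / real N"
  using T N by simp

lemma norm_scheme_solution:
  assumes "scheme_solution \<Omega> Th m0 T N (mt, m)" "n \<le> N" "z \<in> nodes Th"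
  shows "norm (m n z) = 1"
proof (cases n)
  case 0
  have "m 0 = interp \<Omega> Th m0" using assms(1) unfolding scheme_solution_iff[OF T N] by blast
  then show ?thesis using 0 m0 nodes_subset_closure assms(3) by (auto simp: interp_node)
next
  case (Suc k)
  have "mt n z \<noteq> 0" "m n = interp \<Omega> Th (\<lambda>x. mt n x /\<^sub>R norm (mt n x))"
    using assms Suc unfolding scheme_solution_iff[OF T N] by simp_all
  then show ?thesis using assms(3) by (simp add: interp_node)
qed

text \<open>Iterates a chosen step. Unit length of \<open>m n\<close> at the nodes keeps the next
  iterate away from zero there, and normalising restores unit length, so both properties
  propagate.\<close>

lemma scheme_solution_exists: "\<exists>s. scheme_solution \<Omega> Th m0 T N s"
proof -
  \<comment> \<open>A chosen step is constrained at the nodes only; interpolating it gives an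
    element of \<open>Sh\<close> and, by \<open>is_step_cong\<close>, still a step.\<close>
  define S where "S m = interp \<Omega> Th (SOME u. is_step (T / real N) m u)" for m
  define P where "P m = interp \<Omega> Th (\<lambda>x. S m x /\<^sub>R norm (S m x))" for m
  define m where "m = rec_nat (interp \<Omega> Th m0) (\<lambda>_. P)"
  have m_simps: "m 0 = interp \<Omega> Th m0" "m (Suc n) = P (m n)" for n by (simp_all add: m_def)
  define mt where "mt = case_nat (interp \<Omega> Th m0) (\<lambda>n. S (m n))"
  have mt_simps: "mt 0 = interp \<Omega> Th m0" "mt (Suc n) = S (m n)" for n by (simp_all add: mt_def)
  have Sh: "m n \<in> Sh \<Omega> Th" "mt n \<in> Sh \<Omega> Th" for n
    by (cases n; simp add: m_simps mt_simps P_def S_def interp_in_Sh)+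
  have step: "is_step (T / real N) w (S w)" for w
  proof -
    have "is_step (T / real N) w (SOME u. is_step (T / real N) w u)"
      using is_step_exists[OF step_size_pos] by (metis someI_ex)
    then show ?thesis unfolding S_def by (rule is_step_cong) (simp add: interp_node)
  qed
  have norm_m: "\<forall>z\<in>nodes Th. norm (m n z) = 1" for n
  proof (induction n)
    case 0
    then show ?case using m0 nodes_subset_closure by (auto simp: m_simps interp_node)
  next
    case (Suc n)
    have "S (m n) z \<noteq> 0" if "z \<in> nodes Th" for z
      using is_step_norm_ge_1[OF step that, of "m n"] Suc that by fastforce
    then show ?case by (simp add: m_simps P_def interp_node)
  qed
  have nz: "mt (Suc n) z \<noteq> 0" if "z \<in> nodes Th" for n z
    using is_step_norm_ge_1[OF step that, of "m n"] norm_m[of n] that by (force simp: mt_simps)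
  have "scheme_solution \<Omega> Th m0 T N (restrict mt {0..N}, restrict m {0..N})"
    unfolding scheme_solution_iff[OF T N]
    using Sh nz step by (simp add: m_simps mt_simps P_def)
  then show ?thesis by blast
qed

lemma scheme_solution_unique:
  assumes s: "scheme_solution \<Omega> Th m0 T N (mt, m)" and s': "scheme_solution \<Omega> Th m0 T N (mt', m')"
  shows "mt = mt' \<and> m = m'"
proof -
  note sol = s[unfolded scheme_solution_iff[OF T N]] and sol' = s'[unfolded scheme_solution_iff[OF T N]]
  have "n \<le> N \<Longrightarrow> mt n = mt' n \<and> m n = m' n" for n
  proof (induction n)
    case 0
    then show ?case using sol sol' by simp
  next
    case (Suc n)
    then have n: "n < N" and IH: "m n = m' n" by auto
    have "is_step (T / real N) (m n) (mt (Suc n))" "is_step (T / real N) (m n) (mt' (Suc n))"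
      using sol sol' n IH by auto
    then have "mt (Suc n) z = mt' (Suc n) z" if "z \<in> nodes Th" for z
      using is_step_unique[OF step_size_pos] that by blast
    moreover have "mt (Suc n) \<in> Sh \<Omega> Th" "mt' (Suc n) \<in> Sh \<Omega> Th"
      using sol sol' n by auto
    ultimately have "mt (Suc n) = mt' (Suc n)" using Sh_eqI by blast
    then show ?case using sol sol' n by simp
  qed
  \<comment> \<open>Beyond \<open>N\<close> the sequences agree because they are
    extensional.\<close>
  moreover have "mt \<in> extensional {0..N}" "mt' \<in> extensional {0..N}" "m \<in> extensional {0..N}" "m' \<in> extensional {0..N}"
    using sol sol' by (auto simp: PiE_def)
  ultimately show ?thesis by (auto intro: extensionalityI[of _ "{0..N}"])
qed

lemma scheme_solution_energy:
  assumes s: "scheme_solution \<Omega> Th m0 T N (mt, m)" and "n < N"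
  shows "1 / 2 * (grad_norm_h Th (m (n + 1)))\<^sup>2
      + T / real N * (\<Sum>k=0..n. (norm_h Th (\<lambda>x. cross3 (m k x) (discrete_laplacian \<Omega> Th (mt (k + 1)) x)))\<^sup>2)
    \<le> 1 / 2 * (grad_norm_h Th (m 0))\<^sup>2"
proof -
  note sol = s[unfolded scheme_solution_iff[OF T N]]
  define D where "D k = mass (\<lambda>z. cross3 (m k z) (lap (mt (Suc k)) z)) (\<lambda>z. cross3 (m k z) (lap (mt (Suc k)) z))" for k
  have Sh: "m k \<in> Sh \<Omega> Th" "mt k \<in> Sh \<Omega> Th" if "k \<le> N" for k using sol that by auto
  have grad: "(grad_norm_h Th (m k))\<^sup>2 = stiff (m k) (m k)" if "k \<le> N" for k
    using Sh(1)[OF that] stiff_nonneg by (simp add: grad_norm_h_def grad_inner_h_eq_stiff)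
  have diss: "(norm_h Th (\<lambda>x. cross3 (m k x) (discrete_laplacian \<Omega> Th (mt (k + 1)) x)))\<^sup>2 = D k" if "k < N" for k
  proof -
    have "(norm_h Th f)\<^sup>2 = mass f f" for f using mass_nonneg by (simp add: norm_h_def inner_h_eq_mass)
    then show ?thesis
      using Sh(2)[of "Suc k"] that by (simp add: D_def mass_def discrete_laplacian_node)
  qed
  have step: "1 / 2 * stiff (m (Suc k)) (m (Suc k)) + T / real N * D k \<le> 1 / 2 * stiff (m k) (m k)" if "k < N" for k
    unfolding D_def
    by (rule is_step_energy) (use sol that norm_scheme_solution[OF s] in \<open>auto simp: interp_node\<close>)
  \<comment> \<open>Adding up the single-step bounds telescopes the energies. The summation variable
    shadows the outer \<open>k\<close>, which survives only as the upper limit.\<close>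
  have "k < N \<Longrightarrow> 1 / 2 * stiff (m (Suc k)) (m (Suc k)) + T / real N * (\<Sum>k=0..k. D k) \<le> 1 / 2 * stiff (m 0) (m 0)" for k
  proof (induction k)
    case 0
    then show ?case using step[of 0] by simp
  next
    case (Suc k)
    then show ?case using step[of "Suc k"] by (simp add: distrib_left)
  qed
  from this[OF \<open>n < N\<close>] show ?thesis
    using \<open>n < N\<close> grad[of "Suc n"] grad[of 0] diss by simp
qed

end

end

theorem theorem3p3:
  fixes \<Omega> :: "(real^'d) set"
    and F :: "(real^'d) set set set"
    and Th :: "(real^'d) set set"
    and m0 :: "real^'d \<Rightarrow> real^3"
    and T :: real
    and N :: nat
  assumes "CARD('d) \<in> {1, 2, 3}"
    and "\<forall>Th'\<in>F. cartesian_mesh \<Omega> Th'"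
    and "shape_regular F"
    and "quasi_uniform F"
    and "Th \<in> F"
    and "0 < T"
    and "1 \<le> N"
    and "continuous_on (closure \<Omega>) m0"
    and "\<forall>x\<in>closure \<Omega>. norm (m0 x) = 1"
  shows "(\<exists>!s. scheme_solution \<Omega> Th m0 T N s) \<and>
    (\<forall>mt m. scheme_solution \<Omega> Th m0 T N (mt, m) \<longrightarrow>
      (\<forall>n. 0 \<le> n \<and> n \<le> N - 1 \<longrightarrow>
        1 / 2 * (grad_norm_h Th (m (n + 1)))\<^sup>2
          + T / real N * (\<Sum>k=0..n. (norm_h Th (\<lambda>x. cross3 (m k x)
                (discrete_laplacian \<Omega> Th (mt (k + 1)) x)))\<^sup>2)
        \<le> 1 / 2 * (grad_norm_h Th (m 0))\<^sup>2))"
proof -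
  have "cartesian_mesh \<Omega> Th" using assms(2,5) by blast
  then obtain a b M t where mesh: "\<forall>i. a $ i < b $ i" "\<Omega> = box a b"
    "\<forall>i. interval_partition (a $ i) (b $ i) (M i) (t i)"
    "Th = {cbox (\<chi> i. t i (k i)) (\<chi> i. t i (Suc (k i))) | k. \<forall>i. k i < M i}"
    unfolding cartesian_mesh_def by (elim exE conjE) rule
  interpret cart_mesh \<Omega> a b M t Th
    by unfold_locales (use mesh in auto)
  note hyps = assms(6,7,9)
  have "\<exists>!s. scheme_solution \<Omega> Th m0 T N s"
  proof (rule ex_ex1I[OF scheme_solution_exists[OF hyps]])
    fix s s' assume "scheme_solution \<Omega> Th m0 T N s" "scheme_solution \<Omega> Th m0 T N s'"
    then show "s = s'" using scheme_solution_unique[OF hyps] by (cases s; cases s') blast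
  qed
  \<comment> \<open>The subtraction is truncated; \<open>1 \<le> N\<close> is what makes the two
    ranges of \<open>n\<close> agree.\<close>
  moreover have "n < N" if "n \<le> N - 1" for n using that assms(7) by linarith
  ultimately show ?thesis using scheme_solution_energy[OF hyps] by blast
qed

end
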